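(* Let $X$ be a diffusion on $[0,\infty)$ on natural scale with speed measure $m$, absorbed at $0$, which comes down from infinity and hits $0$ in a.s. finite time. Assume there exist constants $C>0$ and $\rho>0$ such that $$I(x):=\int_0^x y\,m(dy)\le Cx^\rho\quad\forall x\in(0,1).$$ Then for every $t>0$ there exists $A_t<\infty$ such that $\mathbb{P}_x(t<\tau_\partial)\le A_t\,x$ for all $x>0$.
   Context: A diffusion on $[0,\infty)$ on natural scale with speed measure $m$ (locally finite positive measure on $(0,\infty)$ charging every nonempty open subset), absorbed at $0$: $X_t=B_{\sigma_t}$ for $t<\tau_\partial$, $X_t=0$ after, with $B$ standard Brownian motion, $A_s=\int L^y_s m(dy)$ ($L^y$ local times), $\sigma_t=\inf\{s:A_s>t\}$, $\tau_\partial$ the first hitting time of $0$. $X$ comes down from infinity iff $\int_1^\infty y\,m(dy)<\infty$; it hits $0$ in a.s. finite time iff $\int_0^1 y\,m(dy)<\infty$. *)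

theory Defs
  imports "HOL-Probability.Probability"
begin

definition brownian_motion_from :: "'a measure \<Rightarrow> real \<Rightarrow> (real \<Rightarrow> 'a \<Rightarrow> real) \<Rightarrow> bool" where
  "brownian_motion_from M x B \<longleftrightarrow>
     prob_space M \<and>
     (\<forall>s\<ge>0. B s \<in> borel_measurable M) \<and>
     (AE \<omega> in M. B 0 \<omega> = x) \<and>
     (AE \<omega> in M. continuous_on {0..} (\<lambda>s. B s \<omega>)) \<and>
     (\<forall>s t. 0 \<le> s \<and> s < t \<longrightarrow>
        distributed M lborel (\<lambda>\<omega>. B t \<omega> - B s \<omega>) (normal_density 0 (sqrt (t - s)))) \<and>
     (\<forall>(n::nat) (tt::nat \<Rightarrow> real). 0 \<le> tt 0 \<and> (\<forall>i<n. tt i < tt (Suc i)) \<longrightarrow>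
        prob_space.indep_vars M (\<lambda>_. borel) (\<lambda>i \<omega>. B (tt (Suc i)) \<omega> - B (tt i) \<omega>) {..<n})"

definition local_times :: "'a measure \<Rightarrow> (real \<Rightarrow> 'a \<Rightarrow> real) \<Rightarrow> (real \<Rightarrow> real \<Rightarrow> 'a \<Rightarrow> real) \<Rightarrow> bool" where
  "local_times M B L \<longleftrightarrow>
     (AE \<omega> in M.
        continuous_on (UNIV \<times> {0..}) (\<lambda>(y, s). L y s \<omega>) \<and>
        (\<forall>y s. 0 \<le> L y s \<omega>) \<and>
        (\<forall>s\<ge>0. \<forall>f \<in> borel_measurable borel.
           (\<integral>\<^sup>+ r. ennreal (f (B r \<omega>)) * indicator {0..s} r \<partial>lborel)
             = (\<integral>\<^sup>+ y. ennreal (f y) * ennreal (L y s \<omega>) \<partial>lborel)))"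

definition additive_functional :: "real measure \<Rightarrow> (real \<Rightarrow> real \<Rightarrow> 'a \<Rightarrow> real) \<Rightarrow> real \<Rightarrow> 'a \<Rightarrow> ennreal" where
  "additive_functional m L s \<omega> = (\<integral>\<^sup>+ y. ennreal (L y s \<omega>) \<partial>m)"

definition time_change :: "real measure \<Rightarrow> (real \<Rightarrow> real \<Rightarrow> 'a \<Rightarrow> real) \<Rightarrow> real \<Rightarrow> 'a \<Rightarrow> real" where
  "time_change m L t \<omega> = Inf {s. 0 \<le> s \<and> additive_functional m L s \<omega> > ennreal t}"

text \<open>Absorption time: first hitting time of 0 by X_t = B_{sigma_t} (infinite if never).\<close>
definition absorption_time :: "real measure \<Rightarrow> (real \<Rightarrow> 'a \<Rightarrow> real) \<Rightarrow> (real \<Rightarrow> real \<Rightarrow> 'a \<Rightarrow> real) \<Rightarrow> 'a \<Rightarrow> ereal" where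
  "absorption_time m B L \<omega> = Inf {ereal u | u. 0 \<le> u \<and> B (time_change m L u \<omega>) \<omega> = 0}"

definition speed_measure :: "real measure \<Rightarrow> bool" where
  "speed_measure m \<longleftrightarrow>
     sets m = sets borel \<and>
     emeasure m {..0} = 0 \<and>
     (\<forall>K. compact K \<and> K \<subseteq> {0<..} \<longrightarrow> emeasure m K < \<infinity>) \<and>
     (\<forall>U. open U \<and> U \<noteq> {} \<and> U \<subseteq> {0<..} \<longrightarrow> emeasure m U > 0)"

end

theory Submission
  imports Defs
begin

text \<open>Let \<open>T\<close> be the first zero of \<open>B\<close>; the absorption time is the value at \<open>T\<close> of the additive
  functional \<open>\<integral> L\<^sup>y m(dy)\<close>. If the local time at \<open>T\<close> satisfies
  \<open>E\<^sub>x (L\<^sup>y)\<^sup>p \<le> c\<^sub>p y\<^bsup>p-1\<^esup> x\<close>, then with the weight \<open>w(y) = y\<^bsup>1-1/p\<^esup>\<close> the bound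
  \<open>L \<le> a w + a\<^bsup>1-p\<^esup> w\<^bsup>1-p\<^esup> L\<^sup>p\<close> and Markov's inequality give a tail linear in \<open>x\<close> as soon as
  \<open>\<integral> w dm < \<infinity>\<close>, which holds when \<open>1/p < \<rho>\<close>. No independence between
  the levels \<open>y\<close> is needed, hence no Markov property of \<open>X\<close>.
  The moment bound comes from an exponential moment of the local time of a single level, obtained
  for the Gaussian random walks \<open>B(k \<delta>)\<close> from a supermartingale built on a mollification of the concave
  function \<open>1 + min x y / y\<close>, and passed to the limit with Fatou's lemma.\<close>

section \<open>A concave barrier and its Taylor bound\<close>

text \<open>The obstacle is the mass of \<open>m\<close> near 0. First moments of the local time are
  of order min(x, y), and \<integral> min(x, y) m(dy) need not be O(x) when \<open>m\<close> has
  infinite mass near 0. Higher moments carry the extra factor \<open>y^(p-1)\<close>, and that is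
  what the growth condition on \<open>I\<close> can absorb. The function 1 + min(x, y)/y is linear
  on either side of its kink at y, and the drop 1/y of its slope there pays for an exponential
  growth rate of order 1/y in the local time. Its value at the killing level 0 is 1, so the
  exponential moment is at most 1 + x/y; removing the 1 leaves x/y, the source of the factor x in
  the theorem. The kernel \<open>tent \<epsilon>\<close>, a triangle of integral 1, stands in for
  the Dirac mass. Brownian motion is given by the laws and independence of its increments, which
  describe its values on a grid directly; hence random walks instead of stochastic calculus. Local
  times come without measurability in \<omega>, so the estimates run through a functional of grid
  values of \<open>B\<close> that dominates their powers.\<close>

definition tent :: "real \<Rightarrow> real \<Rightarrow> real" where
  "tent \<epsilon> v = max 0 (\<epsilon> - \<bar>v\<bar>) / \<epsilon>\<^sup>2"

definition ramp :: "real \<Rightarrow> real \<Rightarrow> real" where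
  "ramp \<epsilon> v = ((max 0 (v + \<epsilon>)) ^ 3 - 2 * (max 0 v) ^ 3 + (max 0 (v - \<epsilon>)) ^ 3) / (6 * \<epsilon>\<^sup>2)"

text \<open>\<open>ramp \<epsilon>\<close> is a mollification of the positive part, with second derivative \<open>tent \<epsilon>\<close>.
  The shift by \<open>\<epsilon>\<close> in the barrier moves its convex kink to the left of 0, so that on positive
  arguments the kink is seen only by steps longer than \<open>\<epsilon>\<close>.\<close>

definition barrier :: "real \<Rightarrow> real \<Rightarrow> real \<Rightarrow> real" where
  "barrier y \<epsilon> z = max 1 (1 + (z + \<epsilon> - ramp \<epsilon> (z - y)) / y)"

text \<open>The truncated cube is C^2 with second derivative \<open>6 * max 0 v\<close>, which is
  6-Lipschitz, so the remainder is at most \<open>6 |h|^3 / 3!\<close>. The proof checks this by the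
  signs of \<open>v\<close> and \<open>v + h\<close>.\<close>

lemma max_cube_taylor:
  fixes v h :: real
  shows "\<bar>(max 0 (v + h)) ^ 3 - (max 0 v) ^ 3 - 3 * (max 0 v)\<^sup>2 * h - 3 * max 0 v * h\<^sup>2\<bar> \<le> \<bar>h\<bar> ^ 3"
proof -
  consider "0 \<le> v" "0 \<le> v + h" | "0 \<le> v" "v + h < 0" | "v < 0" "0 \<le> v + h" | "v < 0" "v + h < 0"
    by linarith
  then show ?thesis
  proof cases
    case 1
    then have "(max 0 (v + h)) ^ 3 - (max 0 v) ^ 3 - 3 * (max 0 v)\<^sup>2 * h - 3 * max 0 v * h\<^sup>2 = h ^ 3"
      by (simp add: power3_eq_cube power2_eq_square algebra_simps)
    then show ?thesis by (simp add: power_abs)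
  next
    case 2
    then have e: "(max 0 (v + h)) ^ 3 - (max 0 v) ^ 3 - 3 * (max 0 v)\<^sup>2 * h - 3 * max 0 v * h\<^sup>2
        = (- h - v) ^ 3 - (- h) ^ 3"
      by (simp add: power3_eq_cube power2_eq_square algebra_simps)
    have "(- h - v) ^ 3 \<le> (- h) ^ 3" "0 \<le> (- h - v) ^ 3"
      using 2 by (intro power_mono zero_le_power; linarith)+
    moreover have "\<bar>h\<bar> = - h" using 2 by simp
    ultimately show ?thesis unfolding e by (simp only: abs_le_iff) linarith
  next
    case 3
    then have "(v + h) ^ 3 \<le> h ^ 3" "0 \<le> (v + h) ^ 3" "\<bar>h\<bar> = h"
      by (auto intro!: power_mono zero_le_power)
    with 3 show ?thesis by simp
  next
    case 4
    then show ?thesis by simp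
  qed
qed

lemma tent_nonneg [simp]: "0 \<le> tent \<epsilon> v"
  by (simp add: tent_def)

lemma tent_le: "0 < \<epsilon> \<Longrightarrow> tent \<epsilon> v \<le> 1 / \<epsilon>"
  by (auto simp: tent_def max_def power2_eq_square divide_simps)

text \<open>\<open>ramp\<close> is the same second difference applied to cubes, so expanding each
  cube produces this expression as the quadratic coefficient.\<close>

lemma tent_eq_second_difference:
  assumes "0 < \<epsilon>"
  shows "tent \<epsilon> v = (max 0 (v + \<epsilon>) - 2 * max 0 v + max 0 (v - \<epsilon>)) / \<epsilon>\<^sup>2"
  using assms by (auto simp: tent_def max_def abs_if)

text \<open>Only a lower bound is wanted because \<open>ramp\<close> enters \<open>barrier\<close>
  with a minus sign. The slope stays an existential \<open>a\<close>: integrated against a centred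
  Gaussian it vanishes.\<close>

lemma ramp_taylor:
  assumes "0 < \<epsilon>"
  shows "\<exists>a. \<forall>h. ramp \<epsilon> v + a * h + h\<^sup>2 * tent \<epsilon> v / 2 - \<bar>h\<bar> ^ 3 / \<epsilon>\<^sup>2 \<le> ramp \<epsilon> (v + h)"
proof (intro exI allI)
  fix h :: real
  let ?d = "\<lambda>v. (max 0 (v + h)) ^ 3 - (max 0 v) ^ 3 - 3 * (max 0 v)\<^sup>2 * h - 3 * max 0 v * h\<^sup>2"
  let ?a = "((max 0 (v + \<epsilon>))\<^sup>2 - 2 * (max 0 v)\<^sup>2 + (max 0 (v - \<epsilon>))\<^sup>2) / (2 * \<epsilon>\<^sup>2)"
  have "ramp \<epsilon> (v + h) - (ramp \<epsilon> v + ?a * h + h\<^sup>2 * tent \<epsilon> v / 2)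
      = (?d (v + \<epsilon>) - 2 * ?d v + ?d (v - \<epsilon>)) / (6 * \<epsilon>\<^sup>2)"
    unfolding ramp_def tent_eq_second_difference[OF assms] using assms
    by (simp add: field_simps add.commute add.left_commute diff_add_eq)
  \<comment> \<open>The three remainders enter with weights 1, 2, 1, in total 4; rounding up to 6
    cancels the denominator.\<close>
  also have "\<dots> \<ge> - 6 * \<bar>h\<bar> ^ 3 / (6 * \<epsilon>\<^sup>2)"
    using max_cube_taylor[of "v + \<epsilon>" h] max_cube_taylor[of v h] max_cube_taylor[of "v - \<epsilon>" h]
    by (intro divide_right_mono) (auto simp: abs_le_iff)
  finally show "ramp \<epsilon> v + ?a * h + h\<^sup>2 * tent \<epsilon> v / 2 - \<bar>h\<bar> ^ 3 / \<epsilon>\<^sup>2 \<le> ramp \<epsilon> (v + h)"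
    by simp
qed

lemma ramp_left: "v \<le> - \<epsilon> \<Longrightarrow> 0 < \<epsilon> \<Longrightarrow> ramp \<epsilon> v = 0"
  by (simp add: ramp_def max_def)

lemma ramp_right: "\<epsilon> \<le> v \<Longrightarrow> 0 < \<epsilon> \<Longrightarrow> ramp \<epsilon> v = v"
  by (simp add: ramp_def max_def field_simps power3_eq_cube power2_eq_square)

lemma ramp_nonneg: assumes "0 < \<epsilon>" shows "0 \<le> ramp \<epsilon> v"
proof -
  have "2 * (max 0 v) ^ 3 \<le> (max 0 (v + \<epsilon>)) ^ 3 + (max 0 (v - \<epsilon>)) ^ 3"
  proof (cases "\<epsilon> \<le> v")
    case True
    then show ?thesis using assms
      by (simp add: max_def power3_eq_cube algebra_simps)
  next
    case False
    have "(2 * max 0 v) ^ 3 \<le> (max 0 (v + \<epsilon>)) ^ 3"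
      using False assms by (intro power_mono) (auto simp: max_def)
    moreover have "0 \<le> (max 0 v) ^ 3" "0 \<le> (max 0 (v - \<epsilon>)) ^ 3" by simp_all
    moreover have "(2 * max 0 v) ^ 3 = 8 * (max 0 v) ^ 3" by (simp add: power_mult_distrib)
    ultimately show ?thesis by linarith
  qed
  then show ?thesis unfolding ramp_def by (intro divide_nonneg_nonneg) auto
qed

lemma ramp_le: assumes "0 < \<epsilon>" shows "ramp \<epsilon> v \<le> max 0 (v + \<epsilon>)"
proof -
  consider "v \<le> - \<epsilon>" | "\<epsilon> \<le> v" | "- \<epsilon> < v" "v < \<epsilon>" by linarith
  then show ?thesis
  proof cases
    case 3
    have "(v + \<epsilon>)\<^sup>2 \<le> (2 * \<epsilon>)\<^sup>2" using 3 by (intro power_mono) auto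
    then have "(v + \<epsilon>) * (v + \<epsilon>)\<^sup>2 \<le> (v + \<epsilon>) * (2 * \<epsilon>)\<^sup>2" using 3 by (intro mult_left_mono) auto
    moreover have "0 \<le> (v + \<epsilon>) * \<epsilon>\<^sup>2" using 3 by simp
    ultimately have "(v + \<epsilon>) ^ 3 \<le> (v + \<epsilon>) * (6 * \<epsilon>\<^sup>2)"
      by (simp add: power3_eq_cube power2_eq_square algebra_simps)
    moreover have "0 \<le> (max 0 v) ^ 3" by simp
    moreover have "(max 0 (v - \<epsilon>)) ^ 3 = 0" "max 0 (v + \<epsilon>) = v + \<epsilon>" using 3 by auto
    ultimately have "(max 0 (v + \<epsilon>)) ^ 3 - 2 * (max 0 v) ^ 3 + (max 0 (v - \<epsilon>)) ^ 3
       \<le> (v + \<epsilon>) * (6 * \<epsilon>\<^sup>2)" by (simp only:)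
    then have "ramp \<epsilon> v \<le> v + \<epsilon>" using assms by (simp add: ramp_def divide_le_eq)
    then show ?thesis by simp
  qed (use assms in \<open>auto simp: ramp_left ramp_right\<close>)
qed

context
  fixes y \<epsilon> :: real
  assumes eps: "0 < \<epsilon>" "\<epsilon> \<le> y / 4"
begin

lemma barrier_ge_1: "1 \<le> barrier y \<epsilon> z"
  by (simp add: barrier_def)

text \<open>Here \<open>ramp \<epsilon> (z - y)\<close> is at most max(0, z - y + \<epsilon>) and
  hence at most z + \<epsilon>, so the cutoff at 1 does not act.\<close>

lemma barrier_right: assumes "- \<epsilon> \<le> z"
  shows "barrier y \<epsilon> z = 1 + (z + \<epsilon> - ramp \<epsilon> (z - y)) / y"
proof -
  have "ramp \<epsilon> (z - y) \<le> z + \<epsilon>" using ramp_le[OF eps(1), of "z - y"] eps assms by auto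
  then show ?thesis using eps by (simp add: barrier_def)
qed

lemma barrier_le_start: "0 < z \<Longrightarrow> barrier y \<epsilon> z \<le> 1 + (z + \<epsilon>) / y"
  using eps ramp_nonneg[OF eps(1), of "z - y"]
  by (subst barrier_right) (auto simp: divide_right_mono)

text \<open>On the support of the tent, z is at most y + \<epsilon>, so (z + \<epsilon>)/y \<le> 3/2
  because \<epsilon> \<le> y/4. The resulting 5/2 is the origin of the rate
  \<open>1 / (5 * y)\<close>: the drift coefficient 1/(2y) is 5/2 times 1/(5y).\<close>

lemma barrier_tent: assumes "0 < z"
  shows "tent \<epsilon> (z - y) * barrier y \<epsilon> z \<le> 5 / 2 * tent \<epsilon> (z - y)"
proof (cases "z \<le> y + \<epsilon>")
  case True
  have "barrier y \<epsilon> z \<le> 1 + (z + \<epsilon>) / y" by (rule barrier_le_start[OF assms])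
  also have "(z + \<epsilon>) / y \<le> 3 / 2" using True eps by (simp add: divide_le_eq)
  finally have "barrier y \<epsilon> z \<le> 5 / 2" by simp
  then show ?thesis by (metis mult.commute mult_left_mono tent_nonneg)
next
  case False
  then have "tent \<epsilon> (z - y) = 0" using eps by (auto simp: tent_def max_def)
  then show ?thesis by simp
qed

text \<open>Two errors of the same cubic size add up, which explains the factor 2: the remainder of
  \<open>ramp\<close>, and the convex kink of the cutoff at 1.\<close>

lemma barrier_taylor:
  assumes z: "0 < z"
  shows "\<exists>a. \<forall>h. barrier y \<epsilon> (z + h)
      \<le> barrier y \<epsilon> z + a * h - h\<^sup>2 * tent \<epsilon> (z - y) / (2 * y) + 2 * \<bar>h\<bar> ^ 3 / (y * \<epsilon>\<^sup>2)"
proof -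
  obtain a where a: "\<And>h. ramp \<epsilon> (z - y) + a * h + h\<^sup>2 * tent \<epsilon> (z - y) / 2 - \<bar>h\<bar> ^ 3 / \<epsilon>\<^sup>2 \<le> ramp \<epsilon> (z - y + h)"
    using ramp_taylor[OF eps(1)] by metis
  have y: "0 < y" using eps by linarith
  show ?thesis
  proof (intro exI allI)
    fix h
    let ?R = "barrier y \<epsilon> z + (1 - a) / y * h - h\<^sup>2 * tent \<epsilon> (z - y) / (2 * y) + \<bar>h\<bar> ^ 3 / (y * \<epsilon>\<^sup>2)"
    have "1 + (z + h + \<epsilon> - ramp \<epsilon> (z - y + h)) / y \<le>
       1 + (z + h + \<epsilon> - (ramp \<epsilon> (z - y) + a * h + h\<^sup>2 * tent \<epsilon> (z - y) / 2 - \<bar>h\<bar> ^ 3 / \<epsilon>\<^sup>2)) / y"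
      using a[of h] y by (intro add_left_mono divide_right_mono) auto
    also have "\<dots> = ?R"
      using z eps y by (subst barrier_right) (auto simp: field_simps)
    finally have 1: "1 + (z + h + \<epsilon> - ramp \<epsilon> (z + h - y)) / y \<le> ?R"
      by (simp add: algebra_simps)
    have 2: "0 \<le> \<bar>h\<bar> ^ 3 / (y * \<epsilon>\<^sup>2)" using y by simp
    \<comment> \<open>From z > 0 the point z + h falls below -\<epsilon> only if |h| \<ge>
      \<epsilon>. There the function without cutoff is below 1 by at most |h|/y, and |h| \<le>
      |h|^3/\<epsilon>^2.\<close>
    have "barrier y \<epsilon> (z + h) \<le> 1 + (z + h + \<epsilon> - ramp \<epsilon> (z + h - y)) / y + \<bar>h\<bar> ^ 3 / (y * \<epsilon>\<^sup>2)"
    proof (cases "- \<epsilon> \<le> z + h")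
      case True
      then show ?thesis using 2 by (subst barrier_right) auto
    next
      case False
      then have h: "\<epsilon> \<le> \<bar>h\<bar>" "h < 0" using z eps by auto
      have r: "ramp \<epsilon> (z + h - y) = 0" using False eps by (intro ramp_left) auto
      have "\<epsilon>\<^sup>2 \<le> \<bar>h\<bar>\<^sup>2" using h eps by (intro power_mono) auto
      then have "\<bar>h\<bar> * \<epsilon>\<^sup>2 \<le> \<bar>h\<bar> * \<bar>h\<bar>\<^sup>2" by (intro mult_left_mono) auto
      then have "\<bar>h\<bar> / y \<le> \<bar>h\<bar> ^ 3 / (y * \<epsilon>\<^sup>2)"
        using y eps by (simp add: field_simps power3_eq_cube power2_eq_square)
      moreover have "- ((z + h + \<epsilon>) / y) \<le> \<bar>h\<bar> / y"
        unfolding minus_divide_left using h z eps y by (intro divide_right_mono) auto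
      moreover have "barrier y \<epsilon> (z + h) = 1"
        using False y unfolding barrier_def r by (auto simp: max_def field_simps)
      ultimately show ?thesis using r by simp
    qed
    also have "\<dots> \<le> ?R + \<bar>h\<bar> ^ 3 / (y * \<epsilon>\<^sup>2)" using 1 by (rule add_right_mono)
    finally have "barrier y \<epsilon> (z + h) \<le> ?R + \<bar>h\<bar> ^ 3 / (y * \<epsilon>\<^sup>2)" .
    moreover have "2 * \<bar>h\<bar> ^ 3 / (y * \<epsilon>\<^sup>2) = \<bar>h\<bar> ^ 3 / (y * \<epsilon>\<^sup>2) + \<bar>h\<bar> ^ 3 / (y * \<epsilon>\<^sup>2)" by simp
    ultimately show "barrier y \<epsilon> (z + h)
      \<le> barrier y \<epsilon> z + (1 - a) / y * h - h\<^sup>2 * tent \<epsilon> (z - y) / (2 * y) + 2 * \<bar>h\<bar> ^ 3 / (y * \<epsilon>\<^sup>2)"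
      by (simp only: add.assoc)
  qed
qed

end

section \<open>Occupation of the killed Gaussian random walk\<close>

abbreviation gaussian :: "real \<Rightarrow> real measure" where
  "gaussian \<delta> \<equiv> density lborel (\<lambda>u. ennreal (normal_density 0 (sqrt \<delta>) u))"

definition survives :: "(nat \<Rightarrow> real) \<Rightarrow> nat \<Rightarrow> bool" where
  "survives s n \<longleftrightarrow> (\<forall>j\<in>{..<n}. 0 < s j)"

text \<open>Term \<open>k\<close> requires positivity up to and including index \<open>k\<close>,
  and the whole sum reads only positions below \<open>n\<close>. Hence the occupation after
  \<open>n\<close> steps of a walk ignores the increment leading to position
  \<open>n\<close>.\<close>

definition occupation :: "real \<Rightarrow> (real \<Rightarrow> real) \<Rightarrow> (nat \<Rightarrow> real) \<Rightarrow> nat \<Rightarrow> real" where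
  "occupation \<delta> f s n = (\<Sum>k<n. if survives s (Suc k) then \<delta> * f (s k) else 0)"

definition walk :: "real \<Rightarrow> (nat \<Rightarrow> real) \<Rightarrow> nat \<Rightarrow> real" where
  "walk x w k = x + (\<Sum>i<k. w i)"

lemma tent_measurable [measurable (raw)]:
  assumes [measurable]: "e \<in> borel_measurable M" "v \<in> borel_measurable M"
  shows "(\<lambda>x. tent (e x) (v x)) \<in> borel_measurable M"
  unfolding tent_def by measurable

lemma barrier_measurable [measurable]: "barrier y \<epsilon> \<in> borel_measurable borel"
  unfolding barrier_def ramp_def by measurable

text \<open>One step of the supermartingale. If q is the exponent of the weight, the Gaussian mean
  of the Taylor bound is at most (1 - q) times the barrier plus an error of order \<delta>^(3/2)
  from the third absolute moment, and exp(q) (1 - q) \<le> 1. Since the barrier is at least 1, the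
  additive error can be made a factor, in which form the bound iterates.\<close>

lemma gaussian_barrier_step:
  assumes eps: "0 < \<epsilon>" "\<epsilon> \<le> y / 4" and \<delta>: "0 < \<delta>" "\<delta> \<le> 1" and z: "0 < z"
  defines "K \<equiv> 4 * exp (1 / (5 * y * \<epsilon>)) / (y * \<epsilon>\<^sup>2)"
  shows "(\<integral>\<^sup>+ u. ennreal (exp (\<delta> * tent \<epsilon> (z - y) / (5 * y)) * barrier y \<epsilon> (z + u)) \<partial>gaussian \<delta>)
    \<le> ennreal ((1 + K * (\<delta> * sqrt \<delta>)) * barrier y \<epsilon> z)"
proof -
  have y: "0 < y" using eps by linarith
  define b where "b = tent \<epsilon> (z - y)"
  define q where "q = \<delta> * b / (5 * y)"
  have b0: "0 \<le> b" by (simp add: b_def)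
  have q0: "0 \<le> q" using b0 \<delta> y by (simp add: q_def)
  \<comment> \<open>A crude bound that keeps the factor \<open>exp q\<close> in front of the error
    bounded uniformly in \<delta> and z.\<close>
  have q1: "q \<le> 1 / (5 * y * \<epsilon>)"
  proof -
    have "\<delta> * b \<le> 1 * (1 / \<epsilon>)" unfolding b_def using \<delta> tent_le[OF eps(1), of "z - y"] eps
      by (intro mult_mono) auto
    then have "q \<le> (1 / \<epsilon>) / (5 * y)" unfolding q_def using y by (intro divide_right_mono) auto
    then show ?thesis by (simp add: ac_simps)
  qed
  obtain a where a: "\<And>h. barrier y \<epsilon> (z + h)
      \<le> barrier y \<epsilon> z + a * h - h\<^sup>2 * b / (2 * y) + 2 * \<bar>h\<bar> ^ 3 / (y * \<epsilon>\<^sup>2)"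
    using barrier_taylor[OF eps z] unfolding b_def by metis
  let ?p = "normal_density 0 (sqrt \<delta>)"
  let ?T = "\<lambda>h. barrier y \<epsilon> z + a * h - h\<^sup>2 * b / (2 * y) + 2 * \<bar>h\<bar> ^ 3 / (y * \<epsilon>\<^sup>2)"
  let ?m = "barrier y \<epsilon> z - \<delta> * b / (2 * y) + 2 * (2 * (\<delta> * sqrt \<delta>) * sqrt (2 / pi)) / (y * \<epsilon>\<^sup>2)"
  have sd: "0 < sqrt \<delta>" using \<delta> by simp
  \<comment> \<open>Gaussian moments of orders 0, 1, 2 and the absolute third moment: the linear
    term vanishes and the quadratic one yields the drift
    \<open>- \<delta> * b / (2 * y)\<close>.\<close>
  have "has_bochner_integral lborel
      (\<lambda>u. barrier y \<epsilon> z * (?p u * (u - 0) ^ (2 * 0)) + a * (?p u * (u - 0) ^ (2 * 0 + 1))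
         - (b / (2 * y)) * (?p u * (u - 0) ^ (2 * 1)) + (2 / (y * \<epsilon>\<^sup>2)) * (?p u * \<bar>u - 0\<bar> ^ (2 * 1 + 1)))
      (barrier y \<epsilon> z * (fact (2 * 0) / ((2 / (sqrt \<delta>)\<^sup>2)^0 * fact 0)) + a * 0
         - (b / (2 * y)) * (fact (2 * 1) / ((2 / (sqrt \<delta>)\<^sup>2)^1 * fact 1))
         + (2 / (y * \<epsilon>\<^sup>2)) * (2^1 * (sqrt \<delta>)^(2 * 1 + 1) * fact 1 * sqrt (2 / pi)))"
    by (intro has_bochner_integral_add has_bochner_integral_diff has_bochner_integral_mult_right
        normal_moment_even normal_moment_odd normal_moment_abs_odd sd)
  moreover have "(\<lambda>u. barrier y \<epsilon> z * (?p u * (u - 0) ^ (2 * 0)) + a * (?p u * (u - 0) ^ (2 * 0 + 1))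
         - (b / (2 * y)) * (?p u * (u - 0) ^ (2 * 1)) + (2 / (y * \<epsilon>\<^sup>2)) * (?p u * \<bar>u - 0\<bar> ^ (2 * 1 + 1)))
      = (\<lambda>u. ?p u * ?T u)"
    by (intro ext) (simp add: algebra_simps power3_eq_cube power2_eq_square)
  moreover have "(sqrt \<delta>)^(2 * 1 + 1) = \<delta> * sqrt \<delta>"
    using \<delta> by (simp add: power3_eq_cube)
  ultimately have hbi: "has_bochner_integral lborel (\<lambda>u. ?p u * ?T u) ?m"
    using \<delta> by (simp add: algebra_simps)
  have pos: "0 \<le> ?p u * ?T u" for u
    using a[of u] barrier_ge_1[OF eps, of "z + u"] by (intro mult_nonneg_nonneg) auto
  have "(\<integral>\<^sup>+ u. ennreal (barrier y \<epsilon> (z + u)) \<partial>gaussian \<delta>)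
      = (\<integral>\<^sup>+ u. ennreal (?p u) * ennreal (barrier y \<epsilon> (z + u)) \<partial>lborel)"
    by (subst nn_integral_density) auto
  also have "\<dots> \<le> (\<integral>\<^sup>+ u. ennreal (?p u * ?T u) \<partial>lborel)"
    using a by (intro nn_integral_mono)
      (auto simp: ennreal_mult'[symmetric] intro!: ennreal_leI mult_left_mono)
  also have "\<dots> = ennreal ?m"
    using pos hbi
    by (simp add: has_bochner_integral_iff nn_integral_eq_integral)
  finally have I: "(\<integral>\<^sup>+ u. ennreal (barrier y \<epsilon> (z + u)) \<partial>gaussian \<delta>) \<le> ennreal ?m" .
  have m: "?m \<le> barrier y \<epsilon> z * (1 - q) + 4 * (\<delta> * sqrt \<delta>) / (y * \<epsilon>\<^sup>2)"
  proof -
    have "b * barrier y \<epsilon> z \<le> 5 / 2 * b" using barrier_tent[OF eps z] by (simp add: b_def)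
    then have "\<delta> / (5 * y) * (b * barrier y \<epsilon> z) \<le> \<delta> / (5 * y) * (5 / 2 * b)"
      using \<delta> y by (intro mult_left_mono) auto
    then have 1: "barrier y \<epsilon> z * q \<le> \<delta> * b / (2 * y)" by (simp add: q_def ac_simps)
    have "sqrt (2 / pi) \<le> 1" using pi_ge_two by (simp add: real_sqrt_le_1_iff)
    then have "2 * (2 * (\<delta> * sqrt \<delta>) * sqrt (2 / pi)) \<le> 2 * (2 * (\<delta> * sqrt \<delta>) * 1)"
      using \<delta> by (intro mult_left_mono) auto
    then have "2 * (2 * (\<delta> * sqrt \<delta>) * sqrt (2 / pi)) / (y * \<epsilon>\<^sup>2) \<le> 2 * (2 * (\<delta> * sqrt \<delta>) * 1) / (y * \<epsilon>\<^sup>2)"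
      using y by (intro divide_right_mono) auto
    with 1 show ?thesis by (simp add: right_diff_distrib)
  qed
  have Phi: "1 \<le> barrier y \<epsilon> z" by (rule barrier_ge_1[OF eps])
  have "exp q * ?m \<le> exp q * (barrier y \<epsilon> z * (1 - q) + 4 * (\<delta> * sqrt \<delta>) / (y * \<epsilon>\<^sup>2))"
    using m by (intro mult_left_mono) auto
  also have "\<dots> = barrier y \<epsilon> z * (exp q * (1 - q)) + exp q * (4 * (\<delta> * sqrt \<delta>) / (y * \<epsilon>\<^sup>2))"
    by (simp add: algebra_simps)
  also have "\<dots> \<le> barrier y \<epsilon> z * 1 + exp (1 / (5 * y * \<epsilon>)) * (4 * (\<delta> * sqrt \<delta>) / (y * \<epsilon>\<^sup>2)) * barrier y \<epsilon> z"
  proof (rule add_mono)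
    have "exp q * (1 - q) \<le> exp q * exp (- q)"
      using exp_ge_add_one_self[of "- q"] by (intro mult_left_mono) auto
    then show "barrier y \<epsilon> z * (exp q * (1 - q)) \<le> barrier y \<epsilon> z * 1"
      using Phi by (intro mult_left_mono) (auto simp: exp_minus field_simps)
    have "exp q * (4 * (\<delta> * sqrt \<delta>) / (y * \<epsilon>\<^sup>2)) \<le> exp (1 / (5 * y * \<epsilon>)) * (4 * (\<delta> * sqrt \<delta>) / (y * \<epsilon>\<^sup>2)) * 1"
      using q1 \<delta> y by (simp only: mult_1_right) (intro mult_right_mono, auto)
    also have "\<dots> \<le> exp (1 / (5 * y * \<epsilon>)) * (4 * (\<delta> * sqrt \<delta>) / (y * \<epsilon>\<^sup>2)) * barrier y \<epsilon> z"
      using Phi \<delta> y by (intro mult_left_mono) auto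
    finally show "exp q * (4 * (\<delta> * sqrt \<delta>) / (y * \<epsilon>\<^sup>2)) \<le> \<dots>" .
  qed
  also have "\<dots> = (1 + K * (\<delta> * sqrt \<delta>)) * barrier y \<epsilon> z"
    by (simp add: K_def algebra_simps)
  finally have fin: "exp q * ?m \<le> (1 + K * (\<delta> * sqrt \<delta>)) * barrier y \<epsilon> z" .
  have "(\<integral>\<^sup>+ u. ennreal (exp (\<delta> * tent \<epsilon> (z - y) / (5 * y)) * barrier y \<epsilon> (z + u)) \<partial>gaussian \<delta>)
      = ennreal (exp q) * (\<integral>\<^sup>+ u. ennreal (barrier y \<epsilon> (z + u)) \<partial>gaussian \<delta>)"
    by (subst nn_integral_cmult[symmetric]) (auto simp: q_def b_def ennreal_mult')
  also have "\<dots> \<le> ennreal (exp q) * ennreal ?m"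
    by (intro mult_left_mono I) auto
  also have "\<dots> \<le> ennreal ((1 + K * (\<delta> * sqrt \<delta>)) * barrier y \<epsilon> z)"
    using fin by (simp add: ennreal_mult'[symmetric] ennreal_leI)
  finally show ?thesis .
qed

lemma walk_measurable:
  "k \<le> n \<Longrightarrow> (\<lambda>w. walk x w k) \<in> borel_measurable (Pi\<^sub>M {..<n} (\<lambda>_. gaussian \<delta>))"
  unfolding walk_def
  by (intro borel_measurable_add borel_measurable_const borel_measurable_sum)
    (auto intro!: measurable_component_singleton[THEN measurable_cong_sets[THEN equalityD1, THEN subsetD, rotated -1]])

lemma survives_measurable [measurable (raw)]:
  assumes "\<And>j. j < n \<Longrightarrow> (\<lambda>w. s w j) \<in> borel_measurable M"
  shows "Measurable.pred M (\<lambda>w. survives (s w) n)"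
  unfolding survives_def
  by (intro pred_intros_finite finite_lessThan borel_measurable_pred_less borel_measurable_const)
    (use assms in auto)

lemma occupation_measurable [measurable (raw)]:
  assumes "\<And>j. j < n \<Longrightarrow> (\<lambda>w. s w j) \<in> borel_measurable M"
    and "\<And>j. j < n \<Longrightarrow> (\<lambda>w. f w (s w j)) \<in> borel_measurable M"
  shows "(\<lambda>w. occupation \<delta> (f w) (s w) n) \<in> borel_measurable M"
  unfolding occupation_def
  by (intro borel_measurable_sum measurable_If borel_measurable_times borel_measurable_const
      survives_measurable) (use assms in auto)

lemma survives_Suc: "survives s (Suc n) \<longleftrightarrow> survives s n \<and> 0 < s n"
  by (auto simp: survives_def less_Suc_eq)

lemma survives_cong: "(\<And>j. j < n \<Longrightarrow> s j = s' j) \<Longrightarrow> survives s n = survives s' n"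
  by (simp add: survives_def)

lemma occupation_cong: "(\<And>j. j < n \<Longrightarrow> s j = s' j) \<Longrightarrow> occupation \<delta> f s n = occupation \<delta> f s' n"
  unfolding occupation_def
  by (intro sum.cong refl if_cong survives_cong) auto

lemma occupation_nonneg: "0 \<le> \<delta> \<Longrightarrow> (\<And>v. 0 \<le> f v) \<Longrightarrow> 0 \<le> occupation \<delta> f s n"
  unfolding occupation_def by (intro sum_nonneg) auto

text \<open>Induction on the number of steps, integrating out the last increment by Tonelli and
  applying the one-step bound conditionally on the earlier ones.\<close>

lemma walk_exponential_bound:
  assumes eps: "0 < \<epsilon>" "\<epsilon> \<le> y / 4" and \<delta>: "0 < \<delta>" "\<delta> \<le> 1"
  defines "K \<equiv> 4 * exp (1 / (5 * y * \<epsilon>)) / (y * \<epsilon>\<^sup>2)"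
  shows "(\<integral>\<^sup>+ w. ennreal (exp (occupation \<delta> (\<lambda>v. tent \<epsilon> (v - y)) (walk x w) n / (5 * y)))
            \<partial>Pi\<^sub>M {..<n} (\<lambda>_. gaussian \<delta>))
      \<le> ennreal ((1 + K * (\<delta> * sqrt \<delta>)) ^ n * barrier y \<epsilon> x)"
proof -
  have y: "0 < y" using eps by linarith
  have K0: "0 \<le> K * (\<delta> * sqrt \<delta>)" using y \<delta> by (simp add: K_def)
  interpret G: product_sigma_finite "\<lambda>_. gaussian \<delta>"
    using \<delta> by (intro product_sigma_finite.intro prob_space_imp_sigma_finite prob_space_normal_density) auto
  let ?f = "\<lambda>v. tent \<epsilon> (v - y)"
  \<comment> \<open>The barrier is frozen at 1 after killing. Since \<open>survives\<close> at
    \<open>n\<close> looks only at indices below \<open>n\<close>, the barrier is still evaluated at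
    the first nonpositive position; the next step replaces that value by 1, which is no increase as
    the barrier is at least 1.\<close>
  let ?H = "\<lambda>n w. ennreal (exp (occupation \<delta> ?f (walk x w) n / (5 * y))
      * (if survives (walk x w) n then barrier y \<epsilon> (walk x w n) else 1))"
  have H: "(\<integral>\<^sup>+ w. ?H n w \<partial>Pi\<^sub>M {..<n} (\<lambda>_. gaussian \<delta>))
      \<le> ennreal ((1 + K * (\<delta> * sqrt \<delta>)) ^ n * barrier y \<epsilon> x)" for n
  proof (induction n)
    case 0
    show ?case by (simp add: PiM_empty occupation_def survives_def walk_def)
  next
    case (Suc n)
    have Hm: "?H m \<in> borel_measurable (Pi\<^sub>M {..<m} (\<lambda>_. gaussian \<delta>))" for m
    proof -
      note [measurable] = walk_measurable[of _ m x \<delta>]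
      have [measurable]: "(\<lambda>w. occupation \<delta> ?f (walk x w) m) \<in> borel_measurable (Pi\<^sub>M {..<m} (\<lambda>_. gaussian \<delta>))"
        "Measurable.pred (Pi\<^sub>M {..<m} (\<lambda>_. gaussian \<delta>)) (\<lambda>w. survives (walk x w) m)"
        by (auto intro!: occupation_measurable survives_measurable walk_measurable
            measurable_compose[OF walk_measurable, where g="\<lambda>v. tent \<epsilon> (v - y)"])
      show ?thesis by measurable
    qed
    have step: "(\<integral>\<^sup>+ u. ?H (Suc n) (w(n := u)) \<partial>gaussian \<delta>)
        \<le> ennreal (1 + K * (\<delta> * sqrt \<delta>)) * ?H n w" for w
    proof -
      \<comment> \<open>Coordinate \<open>n\<close> moves only position \<open>Suc n\<close>;
        survival and occupation up to \<open>Suc n\<close> are therefore constants in the inner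
        integral.\<close>
      have W: "walk x (w(n := u)) k = walk x w k" if "k \<le> n" for u k
        using that by (simp add: walk_def)
      have W': "walk x (w(n := u)) (Suc n) = walk x w n + u" for u
        by (simp add: walk_def)
      have S: "survives (walk x (w(n := u))) k = survives (walk x w) k" if "k \<le> Suc n" for u k
        using that by (intro survives_cong W) auto
      have O: "occupation \<delta> ?f (walk x (w(n := u))) (Suc n) = occupation \<delta> ?f (walk x w) (Suc n)" for u
        by (intro occupation_cong W) auto
      show ?thesis
      proof (cases "survives (walk x w) (Suc n)")
        case True
        let ?E = "exp (occupation \<delta> ?f (walk x w) n / (5 * y))"
        have "(\<integral>\<^sup>+ u. ?H (Suc n) (w(n := u)) \<partial>gaussian \<delta>)
          = (\<integral>\<^sup>+ u. ennreal ?E * ennreal (exp (\<delta> * ?f (walk x w n) / (5 * y)) * barrier y \<epsilon> (walk x w n + u)) \<partial>gaussian \<delta>)"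
          using True
          by (intro nn_integral_cong, simp only: S O W' le_refl)
             (simp add: occupation_def exp_add add_divide_distrib ennreal_mult'[symmetric] mult.assoc)
        also have "\<dots> = ennreal ?E * (\<integral>\<^sup>+ u. ennreal (exp (\<delta> * ?f (walk x w n) / (5 * y)) * barrier y \<epsilon> (walk x w n + u)) \<partial>gaussian \<delta>)"
          by (intro nn_integral_cmult) auto
        also have "\<dots> \<le> ennreal ?E * ennreal ((1 + K * (\<delta> * sqrt \<delta>)) * barrier y \<epsilon> (walk x w n))"
          unfolding K_def using True
          by (intro mult_left_mono gaussian_barrier_step eps \<delta>) (auto simp: survives_Suc)
        also have "\<dots> = ennreal (1 + K * (\<delta> * sqrt \<delta>)) * ?H n w"
          using True K0
          by (simp add: survives_Suc ennreal_mult' mult.left_commute del: ennreal_plus)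
        finally show ?thesis .
      next
        case False
        have "(\<integral>\<^sup>+ u. ?H (Suc n) (w(n := u)) \<partial>gaussian \<delta>)
          = (\<integral>\<^sup>+ u. ennreal (exp (occupation \<delta> ?f (walk x w) n / (5 * y))) \<partial>gaussian \<delta>)"
          using False
          by (intro nn_integral_cong, simp only: S O W' le_refl) (simp add: occupation_def)
        also have "\<dots> = ennreal (exp (occupation \<delta> ?f (walk x w) n / (5 * y)))"
          using prob_space.emeasure_space_1[OF prob_space_normal_density[of "sqrt \<delta>" 0]] \<delta> by simp
        also have "\<dots> \<le> ennreal (1 + K * (\<delta> * sqrt \<delta>)) * ?H n w"
        proof -
          have "1 * (exp (occupation \<delta> ?f (walk x w) n / (5 * y)) * 1)
             \<le> (1 + K * (\<delta> * sqrt \<delta>)) * (exp (occupation \<delta> ?f (walk x w) n / (5 * y))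
             * (if survives (walk x w) n then barrier y \<epsilon> (walk x w n) else 1))"
            using K0 barrier_ge_1[OF eps] by (intro mult_mono) auto
          then show ?thesis
            using K0 by (simp add: ennreal_mult'[symmetric] ennreal_leI del: ennreal_plus)
        qed
        finally show ?thesis .
      qed
    qed
    have "(\<integral>\<^sup>+ w. ?H (Suc n) w \<partial>Pi\<^sub>M {..<Suc n} (\<lambda>_. gaussian \<delta>))
        = (\<integral>\<^sup>+ w. (\<integral>\<^sup>+ u. ?H (Suc n) (w(n := u)) \<partial>gaussian \<delta>) \<partial>Pi\<^sub>M {..<n} (\<lambda>_. gaussian \<delta>))"
      using Hm[of "Suc n"] unfolding lessThan_Suc by (intro G.product_nn_integral_insert) auto
    also have "\<dots> \<le> (\<integral>\<^sup>+ w. ennreal (1 + K * (\<delta> * sqrt \<delta>)) * ?H n w \<partial>Pi\<^sub>M {..<n} (\<lambda>_. gaussian \<delta>))"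
      by (intro nn_integral_mono step)
    also have "\<dots> = ennreal (1 + K * (\<delta> * sqrt \<delta>)) * (\<integral>\<^sup>+ w. ?H n w \<partial>Pi\<^sub>M {..<n} (\<lambda>_. gaussian \<delta>))"
      using Hm[of n] by (intro nn_integral_cmult)
    also have "\<dots> \<le> ennreal (1 + K * (\<delta> * sqrt \<delta>)) * ennreal ((1 + K * (\<delta> * sqrt \<delta>)) ^ n * barrier y \<epsilon> x)"
      by (intro mult_left_mono Suc.IH) auto
    also have "\<dots> = ennreal ((1 + K * (\<delta> * sqrt \<delta>)) ^ Suc n * barrier y \<epsilon> x)"
      using K0 by (simp add: ennreal_mult'[symmetric] mult.assoc del: ennreal_plus)
    finally show ?case .
  qed
  show ?thesis
    by (rule order_trans[OF nn_integral_mono H]) (auto intro!: ennreal_leI simp: barrier_ge_1[OF eps])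
qed

text \<open>The terms of order 0 and \<open>p\<close> of the exponential series. The 1 is kept so
  that it cancels the 1 in the bound 1 + x/y on the exponential moment.\<close>

lemma exp_ge_1_plus_power:
  fixes u :: real
  assumes "0 \<le> u" "0 < p"
  shows "1 + u ^ p / fact p \<le> exp u"
proof -
  have "(\<Sum>n\<in>{0, p}. u ^ n /\<^sub>R fact n) \<le> (\<Sum>n. u ^ n /\<^sub>R fact n)"
    using assms by (intro sum_le_suminf summable_exp_generic) auto
  then show ?thesis using assms by (simp add: exp_def divide_inverse mult.commute)
qed

section \<open>Moments of the occupation by Brownian motion\<close>

text \<open>The laws of the increments enter the moment estimate only through this identity. The
  product criterion for independence wants a nonempty index set, hence \<open>0 < n\<close>.\<close>

lemma brownian_walk_distr:
  assumes bm: "brownian_motion_from M x B" and \<delta>: "0 < \<delta>" and n: "0 < n"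
  shows "distr M (Pi\<^sub>M {..<n} (\<lambda>_. borel)) (\<lambda>\<omega>. \<lambda>i\<in>{..<n}. B (\<delta> * real (Suc i)) \<omega> - B (\<delta> * real i) \<omega>)
     = Pi\<^sub>M {..<n} (\<lambda>_. gaussian \<delta>)"
proof -
  interpret prob_space M using bm by (simp add: brownian_motion_from_def)
  let ?X = "\<lambda>i \<omega>. B (\<delta> * real (Suc i)) \<omega> - B (\<delta> * real i) \<omega>"
  have m[measurable]: "B s \<in> borel_measurable M" if "0 \<le> s" for s
    using bm that by (simp add: brownian_motion_from_def)
  have ind: "indep_vars (\<lambda>_. borel) ?X {..<n}"
    using bm[unfolded brownian_motion_from_def] \<delta>
    by (auto elim!: allE[of _ n] allE[of _ "\<lambda>i. \<delta> * real i"])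
  have D: "distr M borel (?X i) = gaussian \<delta>" for i
  proof -
    have "\<delta> * real (Suc i) - \<delta> * real i = \<delta>" by (simp add: algebra_simps)
    moreover have "distributed M lborel (?X i)
        (normal_density 0 (sqrt (\<delta> * real (Suc i) - \<delta> * real i)))"
      using bm \<delta> unfolding brownian_motion_from_def by auto
    ultimately have "distributed M lborel (?X i) (normal_density 0 (sqrt \<delta>))" by simp
    then have "distr M lborel (?X i) = gaussian \<delta>" by (simp add: distributed_def)
    moreover have "distr M lborel (?X i) = distr M borel (?X i)" by (intro distr_cong) auto
    ultimately show ?thesis by simp
  qed
  have "distr M (Pi\<^sub>M {..<n} (\<lambda>_. borel)) (\<lambda>\<omega>. \<lambda>i\<in>{..<n}. ?X i \<omega>) = Pi\<^sub>M {..<n} (\<lambda>i. distr M borel (?X i))"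
    using n \<delta> ind by (subst indep_vars_iff_distr_eq_PiM'[symmetric]) auto
  then show ?thesis by (simp only: D)
qed

lemma brownian_occupation_exponential:
  assumes bm: "brownian_motion_from M x B" and n: "0 < n"
    and eps: "0 < \<epsilon>" "\<epsilon> \<le> y / 4" and \<delta>: "0 < \<delta>" "\<delta> \<le> 1"
  defines "K \<equiv> 4 * exp (1 / (5 * y * \<epsilon>)) / (y * \<epsilon>\<^sup>2)"
  shows "(\<integral>\<^sup>+ \<omega>. ennreal (exp (occupation \<delta> (\<lambda>v. tent \<epsilon> (v - y)) (\<lambda>k. B (\<delta> * real k) \<omega>) n / (5 * y))) \<partial>M)
      \<le> ennreal ((1 + K * (\<delta> * sqrt \<delta>)) ^ n * barrier y \<epsilon> x)"
proof -
  have m[measurable]: "B s \<in> borel_measurable M" if "0 \<le> s" for s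
    using bm that by (simp add: brownian_motion_from_def)
  let ?X = "\<lambda>\<omega>. \<lambda>i\<in>{..<n}. B (\<delta> * real (Suc i)) \<omega> - B (\<delta> * real i) \<omega>"
  let ?F = "\<lambda>s. ennreal (exp (occupation \<delta> (\<lambda>v. tent \<epsilon> (v - y)) s n / (5 * y)))"
  have X: "?X \<in> measurable M (Pi\<^sub>M {..<n} (\<lambda>_. borel))"
    using \<delta> by (intro measurable_restrict) auto
  have F: "(\<lambda>w. ?F (walk x w)) \<in> borel_measurable (Pi\<^sub>M {..<n} (\<lambda>_. borel))"
  proof -
    have "(\<lambda>w. walk x w j) \<in> borel_measurable (Pi\<^sub>M {..<n} (\<lambda>_. borel))" if "j < n" for j
      unfolding walk_def using that
      by (intro borel_measurable_add borel_measurable_const borel_measurable_sum measurable_component_singleton) auto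
    then have [measurable]: "(\<lambda>w. occupation \<delta> (\<lambda>v. tent \<epsilon> (v - y)) (walk x w) n)
        \<in> borel_measurable (Pi\<^sub>M {..<n} (\<lambda>_. borel))"
      by (intro occupation_measurable) auto
    show ?thesis by measurable
  qed
  have "AE \<omega> in M. B 0 \<omega> = x" using bm by (simp add: brownian_motion_from_def)
  then have "AE \<omega> in M. ?F (\<lambda>k. B (\<delta> * real k) \<omega>) = ?F (walk x (?X \<omega>))"
  proof eventually_elim
    case (elim \<omega>)
    have "walk x (?X \<omega>) k = B (\<delta> * real k) \<omega>" if "k < n" for k
    proof -
      have "(\<Sum>i<k. ?X \<omega> i) = (\<Sum>i<k. B (\<delta> * real (Suc i)) \<omega> - B (\<delta> * real i) \<omega>)"
        using that by (intro sum.cong) auto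
      also have "\<dots> = B (\<delta> * real k) \<omega> - B (\<delta> * real 0) \<omega>"
        by (rule sum_lessThan_telescope)
      finally show ?thesis using elim by (simp add: walk_def)
    qed
    then show ?case by (simp cong: occupation_cong)
  qed
  then have "(\<integral>\<^sup>+ \<omega>. ?F (\<lambda>k. B (\<delta> * real k) \<omega>) \<partial>M) = (\<integral>\<^sup>+ \<omega>. ?F (walk x (?X \<omega>)) \<partial>M)"
    by (rule nn_integral_cong_AE)
  also have "\<dots> = (\<integral>\<^sup>+ w. ?F (walk x w) \<partial>distr M (Pi\<^sub>M {..<n} (\<lambda>_. borel)) ?X)"
    using F by (intro nn_integral_distr[symmetric] X) simp
  also have "\<dots> \<le> ennreal ((1 + K * (\<delta> * sqrt \<delta>)) ^ n * barrier y \<epsilon> x)"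
    unfolding brownian_walk_distr[OF bm \<delta>(1) n] K_def by (rule walk_exponential_bound[OF eps \<delta>])
  finally show ?thesis .
qed

text \<open>Subtracting 1 from the exponential moment before comparing with the power is what leaves
  x/y in the limit of small \<delta> and \<epsilon>. The factors of the \<open>n\<close> steps are
  collected by (1 + a)^n \<le> exp(a n).\<close>

lemma brownian_occupation_moment:
  assumes bm: "brownian_motion_from M x B" and n: "0 < n"
    and eps: "0 < \<epsilon>" "\<epsilon> \<le> y / 4" and \<delta>: "0 < \<delta>" "\<delta> \<le> 1" and x: "0 < x" and p: "0 < p"
  defines "K \<equiv> 4 * exp (1 / (5 * y * \<epsilon>)) / (y * \<epsilon>\<^sup>2)"
  shows "(\<integral>\<^sup>+ \<omega>. ennreal (occupation \<delta> (\<lambda>v. tent \<epsilon> (v - y)) (\<lambda>k. B (\<delta> * real k) \<omega>) n ^ p) \<partial>M)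
      \<le> ennreal (fact p * (5 * y) ^ p * (exp (K * (\<delta> * sqrt \<delta>) * real n) * (1 + (x + \<epsilon>) / y) - 1))"
proof -
  interpret prob_space M using bm by (simp add: brownian_motion_from_def)
  have y: "0 < y" using eps by linarith
  have K0: "0 \<le> K * (\<delta> * sqrt \<delta>)" using y \<delta> by (simp add: K_def)
  define Z where "Z \<omega> = occupation \<delta> (\<lambda>v. tent \<epsilon> (v - y)) (\<lambda>k. B (\<delta> * real k) \<omega>) n" for \<omega>
  define b where "b = exp (K * (\<delta> * sqrt \<delta>) * real n) * (1 + (x + \<epsilon>) / y)"
  have m: "B s \<in> borel_measurable M" if "0 \<le> s" for s
    using bm that by (simp add: brownian_motion_from_def)
  have [measurable]: "Z \<in> borel_measurable M"
    unfolding Z_def using \<delta>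
    by (intro occupation_measurable tent_measurable borel_measurable_diff borel_measurable_const m) auto
  have Z0: "0 \<le> Z \<omega>" for \<omega> unfolding Z_def using \<delta> by (intro occupation_nonneg) auto
  have b1: "1 \<le> b" 
  proof -
    have "1 * 1 \<le> exp (K * (\<delta> * sqrt \<delta>) * real n) * (1 + (x + \<epsilon>) / y)"
      using K0 x y eps by (intro mult_mono) auto
    then show ?thesis by (simp add: b_def)
  qed
  have "(1 + K * (\<delta> * sqrt \<delta>)) ^ n \<le> exp (K * (\<delta> * sqrt \<delta>)) ^ n"
    using K0 by (intro power_mono exp_ge_add_one_self) auto
  also have "\<dots> = exp (K * (\<delta> * sqrt \<delta>) * real n)" by (simp add: exp_of_nat2_mult)
  finally have "(1 + K * (\<delta> * sqrt \<delta>)) ^ n * barrier y \<epsilon> x \<le> b"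
    unfolding b_def using barrier_le_start[OF eps x] barrier_ge_1[OF eps, of x]
    by (intro mult_mono) auto
  then have "(\<integral>\<^sup>+ \<omega>. ennreal (exp (Z \<omega> / (5 * y))) \<partial>M) \<le> ennreal b"
    unfolding Z_def
    by (intro order_trans[OF brownian_occupation_exponential[OF bm n eps \<delta>]])
       (auto simp: K_def intro: ennreal_leI)
  moreover have "(\<integral>\<^sup>+ \<omega>. ennreal (exp (Z \<omega> / (5 * y))) \<partial>M)
      = (\<integral>\<^sup>+ \<omega>. ennreal (exp (Z \<omega> / (5 * y)) - 1) + ennreal 1 \<partial>M)"
    using Z0 y by (intro nn_integral_cong) (simp add: ennreal_plus[symmetric] del: ennreal_plus ennreal_1)
  moreover have "\<dots> = (\<integral>\<^sup>+ \<omega>. ennreal (exp (Z \<omega> / (5 * y)) - 1) \<partial>M) + 1"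
    by (subst nn_integral_add) (auto simp: emeasure_space_1)
  ultimately have I: "(\<integral>\<^sup>+ \<omega>. ennreal (exp (Z \<omega> / (5 * y)) - 1) \<partial>M) + 1 \<le> ennreal b" by simp
  have I': "(\<integral>\<^sup>+ \<omega>. ennreal (exp (Z \<omega> / (5 * y)) - 1) \<partial>M) \<le> ennreal (b - 1)"
  proof (cases "(\<integral>\<^sup>+ \<omega>. ennreal (exp (Z \<omega> / (5 * y)) - 1) \<partial>M)")
    case (real r)
    then have "ennreal (r + 1) \<le> ennreal b" using I by simp
    then have "r \<le> b - 1" using b1 real(1) by (subst (asm) ennreal_le_iff) auto
    then show ?thesis unfolding real(2) by (intro ennreal_leI)
  next
    case top
    then show ?thesis using I by (simp add: top_unique)
  qed
  have "(\<integral>\<^sup>+ \<omega>. ennreal (Z \<omega> ^ p) \<partial>M)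
      \<le> (\<integral>\<^sup>+ \<omega>. ennreal (fact p * (5 * y) ^ p) * ennreal (exp (Z \<omega> / (5 * y)) - 1) \<partial>M)"
  proof (intro nn_integral_mono)
    fix \<omega>
    have "(Z \<omega> / (5 * y)) ^ p / fact p \<le> exp (Z \<omega> / (5 * y)) - 1"
      using exp_ge_1_plus_power[of "Z \<omega> / (5 * y)" p] Z0 y p by auto
    then have "Z \<omega> ^ p \<le> fact p * (5 * y) ^ p * (exp (Z \<omega> / (5 * y)) - 1)"
      using y by (simp add: power_divide divide_le_eq mult.commute)
    then show "ennreal (Z \<omega> ^ p) \<le> ennreal (fact p * (5 * y) ^ p) * ennreal (exp (Z \<omega> / (5 * y)) - 1)"
      using y by (simp add: ennreal_mult'[symmetric] ennreal_leI)
  qed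
  also have "\<dots> \<le> ennreal (fact p * (5 * y) ^ p) * ennreal (b - 1)"
    by (subst nn_integral_cmult) (auto intro!: mult_left_mono I')
  also have "\<dots> = ennreal (fact p * (5 * y) ^ p * (b - 1))"
    using y by (simp add: ennreal_mult')
  finally show ?thesis unfolding Z_def b_def .
qed

text \<open>The step \<open>\<delta> = 16\<^sup>-\<^sup>n\<close> and the number \<open>32\<^sup>n\<close> of steps make the time horizon \<open>2\<^sup>n\<close> tend to
  infinity, while the accumulated Taylor error, of order \<open>32\<^sup>n \<delta>\<^sup>3\<^sup>/\<^sup>2 = 2\<^sup>-\<^sup>n\<close>, vanishes.\<close>

definition grid_occupation :: "(real \<Rightarrow> real) \<Rightarrow> nat \<Rightarrow> nat \<Rightarrow> real \<Rightarrow> real" where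
  "grid_occupation b j n y =
     occupation ((1/16) ^ n) (\<lambda>v. tent (y / (real j + 4)) (v - y)) (\<lambda>k. b ((1/16) ^ n * real k)) (32 ^ n)"

text \<open>A majorant of the \<open>p\<close>-th power of half the local time that uses
  \<open>B\<close> at countably many times only, hence is jointly measurable in level and \<omega>.
  Lower limits suit Fatou's lemma; the width y/(j + 4) respects \<epsilon> \<le> y/4 from
  \<open>j = 0\<close> on.\<close>

definition local_moment :: "(real \<Rightarrow> real) \<Rightarrow> nat \<Rightarrow> real \<Rightarrow> ennreal" where
  "local_moment b p y = liminf (\<lambda>j. liminf (\<lambda>n. ennreal (grid_occupation b j n y ^ p)))"

lemma grid_occupation_measurable:
  assumes "\<And>s. 0 \<le> s \<Longrightarrow> B s \<in> borel_measurable M"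
  shows "(\<lambda>z. grid_occupation (\<lambda>s. B s (snd z)) j n (fst z)) \<in> borel_measurable (borel \<Otimes>\<^sub>M M)"
proof -
  have [measurable]: "(\<lambda>z. B ((1/16) ^ n * real k) (snd z)) \<in> borel_measurable (borel \<Otimes>\<^sub>M M)" for k
    by (rule measurable_compose[OF measurable_snd]) (simp add: assms)
  show ?thesis unfolding grid_occupation_def
    by (intro occupation_measurable) measurable
qed

lemma local_moment_measurable:
  assumes "\<And>s. 0 \<le> s \<Longrightarrow> B s \<in> borel_measurable M"
  shows "(\<lambda>z. local_moment (\<lambda>s. B s (snd z)) p (fst z)) \<in> borel_measurable (borel \<Otimes>\<^sub>M M)"
  unfolding local_moment_def
  by (intro borel_measurable_liminf measurable_compose[OF _ measurable_ennreal]
      borel_measurable_power grid_occupation_measurable assms)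

text \<open>Fatou's lemma twice. The order of the limits matters: the error constant
  \<open>K j\<close> explodes as the width shrinks, so the time step must vanish first with
  \<open>j\<close> fixed.\<close>

lemma local_moment_expectation:
  assumes bm: "brownian_motion_from M x B" and x: "0 < x" and y: "0 < y" and p: "0 < p"
  shows "(\<integral>\<^sup>+ \<omega>. local_moment (\<lambda>s. B s \<omega>) p y \<partial>M) \<le> ennreal (fact p * (5 * y) ^ p * (x / y))"
proof -
  have m: "B s \<in> borel_measurable M" if "0 \<le> s" for s
    using bm that by (simp add: brownian_motion_from_def)
  have [measurable]: "(\<lambda>\<omega>. grid_occupation (\<lambda>s. B s \<omega>) j n y) \<in> borel_measurable M" for j n
    unfolding grid_occupation_def
    by (intro occupation_measurable tent_measurable borel_measurable_diff borel_measurable_const m) auto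
  define \<epsilon> where "\<epsilon> j = y / (real j + 4)" for j :: nat
  define K where "K j = 4 * exp (1 / (5 * y * \<epsilon> j)) / (y * (\<epsilon> j)\<^sup>2)" for j
  have eps: "0 < \<epsilon> j" "\<epsilon> j \<le> y / 4" for j
    using y by (auto simp: \<epsilon>_def divide_simps)
  have bound: "(\<integral>\<^sup>+ \<omega>. ennreal (grid_occupation (\<lambda>s. B s \<omega>) j n y ^ p) \<partial>M)
      \<le> ennreal (fact p * (5 * y) ^ p * (exp (K j * (1/2) ^ n) * (1 + (x + \<epsilon> j) / y) - 1))" for j n
  proof -
    have "sqrt ((1/16) ^ n) = (1/4::real) ^ n"
      by (rule real_sqrt_unique) (simp_all add: power2_eq_square power_mult_distrib[symmetric])
    then have e: "(1/16) ^ n * sqrt ((1/16) ^ n) * real (32 ^ n) = (1/2) ^ n"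
      by (simp add: power_mult_distrib[symmetric])
    have "(1/16::real) ^ n \<le> 1" by (intro power_le_one) auto
    then show ?thesis
      using brownian_occupation_moment[OF bm, of "32 ^ n" "\<epsilon> j" y "(1/16) ^ n" p] eps x p e
      unfolding grid_occupation_def \<epsilon>_def[symmetric] K_def[symmetric]
      by (simp add: mult.assoc)
  qed
  have inner: "liminf (\<lambda>n. ennreal (fact p * (5 * y) ^ p * (exp (K j * (1/2) ^ n) * (1 + (x + \<epsilon> j) / y) - 1)))
     = ennreal (fact p * (5 * y) ^ p * ((x + \<epsilon> j) / y))" for j
  proof (rule lim_imp_Liminf)
    have "(\<lambda>n. ennreal (fact p * (5 * y) ^ p * (exp (K j * (1/2) ^ n) * (1 + (x + \<epsilon> j) / y) - 1)))
       \<longlonglongrightarrow> ennreal (fact p * (5 * y) ^ p * (exp (K j * 0) * (1 + (x + \<epsilon> j) / y) - 1))"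
      by (intro tendsto_intros LIMSEQ_power_zero) auto
    then show "(\<lambda>n. ennreal (fact p * (5 * y) ^ p * (exp (K j * (1/2) ^ n) * (1 + (x + \<epsilon> j) / y) - 1)))
       \<longlonglongrightarrow> ennreal (fact p * (5 * y) ^ p * ((x + \<epsilon> j) / y))" by simp
  qed simp
  have outer: "liminf (\<lambda>j. ennreal (fact p * (5 * y) ^ p * ((x + \<epsilon> j) / y)))
     = ennreal (fact p * (5 * y) ^ p * ((x + 0) / y))"
  proof (rule lim_imp_Liminf)
    have "\<epsilon> \<longlonglongrightarrow> 0" unfolding \<epsilon>_def by real_asymp
    then show "(\<lambda>j. ennreal (fact p * (5 * y) ^ p * ((x + \<epsilon> j) / y)))
        \<longlonglongrightarrow> ennreal (fact p * (5 * y) ^ p * ((x + 0) / y))"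
      using y by (intro tendsto_intros) auto
  qed simp
  have "(\<integral>\<^sup>+ \<omega>. local_moment (\<lambda>s. B s \<omega>) p y \<partial>M)
      \<le> liminf (\<lambda>j. \<integral>\<^sup>+ \<omega>. liminf (\<lambda>n. ennreal (grid_occupation (\<lambda>s. B s \<omega>) j n y ^ p)) \<partial>M)"
    unfolding local_moment_def by (intro nn_integral_liminf) measurable
  also have "\<dots> \<le> liminf (\<lambda>j. liminf (\<lambda>n. \<integral>\<^sup>+ \<omega>. ennreal (grid_occupation (\<lambda>s. B s \<omega>) j n y ^ p) \<partial>M))"
    by (intro Liminf_mono always_eventually allI nn_integral_liminf) measurable
  also have "\<dots> \<le> liminf (\<lambda>j. liminf (\<lambda>n.
      ennreal (fact p * (5 * y) ^ p * (exp (K j * (1/2) ^ n) * (1 + (x + \<epsilon> j) / y) - 1))))"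
    by (intro Liminf_mono always_eventually allI bound)
  also have "\<dots> = ennreal (fact p * (5 * y) ^ p * (x / y))"
    unfolding inner outer by simp
  finally show ?thesis .
qed

section \<open>Paths with local times\<close>

lemma first_zero:
  fixes b :: "real \<Rightarrow> real"
  assumes c: "continuous_on {0..} b" and b0: "0 < b 0" and s: "0 \<le> s" "b s \<le> 0"
  obtains T where "0 \<le> T" "b T = 0" "\<And>r. 0 \<le> r \<Longrightarrow> r < T \<Longrightarrow> 0 < b r"
proof -
  define S where "S = {s \<in> {0..}. b s = 0}"
  have ivt: "\<exists>r\<in>S. r \<le> v" if v: "0 \<le> v" "b v \<le> 0" for v
  proof -
    have "\<exists>r\<ge>0. r \<le> v \<and> b r = 0"
      using v b0 by (intro IVT2') (auto intro: continuous_on_subset[OF c])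
    then show ?thesis by (auto simp: S_def)
  qed
  have cl: "closed S" unfolding S_def
    by (intro continuous_closed_preimage_constant[OF c]) auto
  have bb: "bdd_below S" by (auto simp: S_def)
  have ne: "S \<noteq> {}" using ivt[OF s] by auto
  have I: "Inf S \<in> S" by (rule closed_contains_Inf[OF ne bb cl])
  show thesis
  proof (rule that)
    show "0 \<le> Inf S" "b (Inf S) = 0" using I by (auto simp: S_def)
    fix r assume r: "0 \<le> r" "r < Inf S"
    show "0 < b r"
    proof (rule ccontr)
      assume "\<not> 0 < b r"
      then obtain q where "q \<in> S" "q \<le> r" using ivt[of r] r by auto
      then show False using cInf_lower[OF _ bb, of q] r by auto
    qed
  qed
qed

text \<open>A single path outside the exceptional null set; the arguments in this locale are
  deterministic. Monotonicity of \<open>l\<close> in time is derived from the occupation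
  formula.\<close>

locale local_time_path =
  fixes b :: "real \<Rightarrow> real" and l :: "real \<Rightarrow> real \<Rightarrow> real"
  assumes b_cont: "continuous_on {0..} b"
    and l_cont: "continuous_on (UNIV \<times> {0..}) (\<lambda>(y, s). l y s)"
    and l_nonneg: "0 \<le> l y s"
    and occupation_formula: "0 \<le> s \<Longrightarrow> f \<in> borel_measurable borel \<Longrightarrow>
           (\<integral>\<^sup>+ r. ennreal (f (b r)) * indicator {0..s} r \<partial>lborel)
             = (\<integral>\<^sup>+ y. ennreal (f y) * ennreal (l y s) \<partial>lborel)"
begin

lemma l_cont_space: assumes "0 \<le> s" shows "continuous_on UNIV (\<lambda>y. l y s)"
proof -
  have "continuous_on UNIV (\<lambda>y. (\<lambda>(y, s). l y s) (y, s))"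
    using assms by (intro continuous_on_compose2[OF l_cont]) (auto intro!: continuous_intros)
  then show ?thesis by simp
qed

lemma l_measurable [measurable]: "0 \<le> s \<Longrightarrow> (\<lambda>y. l y s) \<in> borel_measurable borel"
  by (intro borel_measurable_continuous_onI l_cont_space)

lemma occupation_indicator:
  assumes "0 \<le> s" "A \<in> sets borel"
  shows "(\<integral>\<^sup>+ r. indicator A (b r) * indicator {0..s} r \<partial>lborel) = (\<integral>\<^sup>+ y. ennreal (l y s) * indicator A y \<partial>lborel)"
  using occupation_formula[OF assms(1), of "indicator A"] assms(2)
  by (simp add: ennreal_indicator mult.commute)

text \<open>The occupation formula sees only averages over levels. Continuity in the level spreads
  the strict increase at \<open>y\<close>, with a gap between \<open>a\<close> and \<open>c\<close>,
  over an interval of levels, so the time spent there must grow.\<close>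

lemma visits_where_increasing:
  assumes s: "0 \<le> s" "0 \<le> s'" and lt: "l y s < l y s'" and U: "open U" "y \<in> U"
  shows "\<exists>r. s < r \<and> r \<le> s' \<and> b r \<in> U"
proof -
  obtain a where a: "l y s < a" "a < l y s'" using lt dense by blast
  obtain c where c: "a < c" "c < l y s'" using a dense by blast
  have a0: "0 \<le> a" using l_nonneg[of y s] a by linarith
  let ?V = "U \<inter> {z. l z s < a} \<inter> {z. c < l z s'}"
  have "open ?V" using s
    by (intro open_Int U open_Collect_less l_cont_space) auto
  moreover have "y \<in> ?V" using U a c by auto
  ultimately obtain e where e: "0 < e" "cball y e \<subseteq> ?V"
    using open_contains_cball by metis
  let ?A = "{y - e..y + e}"
  have A: "?A \<subseteq> ?V" using e by (auto simp: cball_eq_atLeastAtMost)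
  then have A1: "\<And>z. z \<in> ?A \<Longrightarrow> l z s \<le> a" and A2: "\<And>z. z \<in> ?A \<Longrightarrow> c \<le> l z s'"
    by (blast intro: less_imp_le)+
  have "(\<integral>\<^sup>+ z. ennreal (l z s) * indicator ?A z \<partial>lborel) \<le> (\<integral>\<^sup>+ z. ennreal a * indicator ?A z \<partial>lborel)"
    using A1 by (intro nn_integral_mono) (auto simp: indicator_def intro!: ennreal_leI)
  also have "\<dots> = ennreal (a * (2 * e))"
    using e a0 by (simp add: nn_integral_cmult_indicator ennreal_mult' mult.commute)
  also have "\<dots> < ennreal (c * (2 * e))"
    using a0 c e by (intro ennreal_lessI) (auto intro!: mult_pos_pos)
  also have "\<dots> = (\<integral>\<^sup>+ z. ennreal c * indicator ?A z \<partial>lborel)"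
    using e a0 c by (simp add: nn_integral_cmult_indicator ennreal_mult' mult.commute)
  also have "\<dots> \<le> (\<integral>\<^sup>+ z. ennreal (l z s') * indicator ?A z \<partial>lborel)"
    using A2 by (intro nn_integral_mono) (auto simp: indicator_def intro!: ennreal_leI)
  finally have "(\<integral>\<^sup>+ r. indicator ?A (b r) * indicator {0..s} r \<partial>lborel)
      < (\<integral>\<^sup>+ r. indicator ?A (b r) * indicator {0..s'} r \<partial>lborel)"
    using s by (simp add: occupation_indicator)
  then obtain r where "(indicator ?A (b r) * indicator {0..s} r :: ennreal) < indicator ?A (b r) * indicator {0..s'} r"
    using nn_integral_mono[of lborel "\<lambda>r. indicator ?A (b r) * indicator {0..s'} r"
        "\<lambda>r. indicator ?A (b r) * indicator {0..s} r"] by (meson not_le)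
  then have "s < r" "r \<le> s'" "b r \<in> ?A" by (auto split: split_indicator_asm)
  then show ?thesis using A by blast
qed

text \<open>A decrease would be an increase from \<open>s'\<close> to \<open>s\<close>, requiring a
  visit at some r with s' < r \<le> s, an empty range.\<close>

lemma l_mono: "0 \<le> s \<Longrightarrow> s \<le> s' \<Longrightarrow> l y s \<le> l y s'"
  using visits_where_increasing[of s' s y UNIV] by force

text \<open>By continuity the path stays in \<open>U\<close> for a positive time after
  \<open>v\<close>; if no level in \<open>U\<close> gained local time, the occupation time of
  \<open>U\<close> could not have grown.\<close>

lemma increases_where_visited:
  assumes s: "0 \<le> s" "s < v" "v < s'" and U: "open U" "b v \<in> U"
  shows "\<exists>y\<in>U. l y s < l y s'"
proof (rule ccontr)
  assume neg: "\<not> ?thesis"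
  have [measurable]: "U \<in> sets borel" using U by simp
  have "\<forall>\<^sub>F r in at v within {0..}. b r \<in> U"
    using b_cont s U unfolding continuous_on_def by (auto intro: topological_tendstoD)
  then obtain d where d: "0 < d" "\<And>r. r \<in> {0..} \<Longrightarrow> dist r v < d \<Longrightarrow> b r \<in> U"
    using U unfolding eventually_at by metis
  define w where "w = min (v + d / 2) s'"
  have w: "v < w" "w \<le> s'" "\<And>r. v \<le> r \<Longrightarrow> r \<le> w \<Longrightarrow> b r \<in> U"
    using d s by (auto simp: w_def dist_real_def intro!: d(2))
  \<comment> \<open>The path is continuous on nonnegative times only; extending it by 0 makes it
    Borel on the whole line.\<close>
  define g where "g r = indicator {0..} r *\<^sub>R b r" for r
  have [measurable]: "g \<in> borel_measurable borel"
    unfolding g_def by (intro borel_measurable_continuous_on_indicator b_cont) auto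
  let ?O = "\<lambda>s. (\<integral>\<^sup>+ r. indicator U (g r) * indicator {0..s} r \<partial>lborel)"
  have O: "(\<integral>\<^sup>+ r. indicator U (b r) * indicator {0..s} r \<partial>lborel) = ?O s" for s
    by (intro nn_integral_cong) (auto simp: indicator_def g_def)
  have fin: "?O s < \<infinity>"
  proof -
    have "?O s \<le> (\<integral>\<^sup>+ r. indicator {0..s} r \<partial>lborel)"
      by (intro nn_integral_mono) (auto simp: indicator_def)
    also have "\<dots> < \<infinity>" using s by simp
    finally show ?thesis .
  qed
  have "?O s + ennreal (w - v) = (\<integral>\<^sup>+ r. indicator U (g r) * indicator {0..s} r + indicator {v..w} r \<partial>lborel)"
    using w by (subst nn_integral_add) auto
  also have "\<dots> \<le> ?O s'"
    using w s by (intro nn_integral_mono) (auto simp: indicator_def g_def)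
  also have "\<dots> = (\<integral>\<^sup>+ y. ennreal (l y s') * indicator U y \<partial>lborel)"
    using s by (simp add: O[symmetric] occupation_indicator)
  also have "\<dots> \<le> (\<integral>\<^sup>+ y. ennreal (l y s) * indicator U y \<partial>lborel)"
    using neg by (intro nn_integral_mono) (auto simp: indicator_def not_less intro!: ennreal_leI)
  also have "\<dots> = ?O s"
    using s by (simp add: O[symmetric] occupation_indicator)
  finally have "?O s + ennreal (w - v) \<le> ?O s" .
  then show False using fin w
    by (cases "?O s") (auto simp: ennreal_plus[symmetric] simp del: ennreal_plus)
qed

section \<open>The clock of a path and its inverse\<close>

context
  fixes m :: "real measure"
  assumes m: "speed_measure m"
begin

lemma sets_m [measurable_cong]: "sets m = sets borel"
  using m by (simp add: speed_measure_def)

definition clock :: "real \<Rightarrow> ennreal" where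
  "clock s = (\<integral>\<^sup>+ y. ennreal (l y s) \<partial>m)"

lemma clock_mono: "0 \<le> s \<Longrightarrow> s \<le> s' \<Longrightarrow> clock s \<le> clock s'"
  unfolding clock_def by (intro nn_integral_mono ennreal_leI l_mono)

lemma AE_speed_pos: "AE y in m. 0 < y"
proof (rule AE_I')
  show "{..0} \<in> null_sets m" using m by (auto simp: null_sets_def speed_measure_def)
qed auto

text \<open>A nonpositive path adds no local time at positive levels, and \<open>m\<close> charges
  only those.\<close>

lemma clock_flat:
  assumes s: "0 \<le> s" "s \<le> s'" and neg: "\<And>r. s < r \<Longrightarrow> r \<le> s' \<Longrightarrow> b r \<le> 0"
  shows "clock s = clock s'"
  unfolding clock_def
proof (rule nn_integral_cong_AE)
  show "AE y in m. ennreal (l y s) = ennreal (l y s')"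
    using AE_speed_pos
  proof eventually_elim
    case (elim y)
    have "\<not> l y s < l y s'"
      using visits_where_increasing[of s s' y "{0<..}"] s neg elim by force
    then show ?case using l_mono[of s s' y] s by (auto intro: antisym)
  qed
qed

text \<open>A visit to a positive point makes the local time grow at some positive level, hence on a
  nonempty open set of such levels, which \<open>m\<close> charges.\<close>

lemma clock_strict:
  assumes s: "0 \<le> s" "s < v" "v < s'" and pos: "0 < b v" and fin: "clock s < \<infinity>"
  shows "clock s < clock s'"
proof -
  have [measurable]: "(\<lambda>y. l y s) \<in> borel_measurable borel" "(\<lambda>y. l y s') \<in> borel_measurable borel"
    using s by (auto intro: l_measurable)
  obtain y where y: "0 < y" "l y s < l y s'"
    using increases_where_visited[of s v s' "{0<..}"] s pos by auto
  let ?V = "{0<..} \<inter> {y. l y s < l y s'}"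
  have "open ?V" using s by (intro open_Int open_Collect_less l_cont_space) auto
  then have V: "0 < emeasure m ?V" using m y unfolding speed_measure_def by blast
  let ?D = "\<integral>\<^sup>+ y. ennreal (l y s' - l y s) \<partial>m"
  have "?D \<noteq> 0"
  proof
    assume "?D = 0"
    then have "AE y in m. ennreal (l y s' - l y s) = 0"
      by (subst (asm) nn_integral_0_iff_AE) auto
    then have "AE y in m. y \<notin> ?V" by eventually_elim (auto simp: ennreal_eq_0_iff)
    then have "emeasure m ?V = 0"
      using \<open>open ?V\<close> by (subst (asm) AE_iff_measurable[of ?V]) (auto simp: sets_m sets_eq_imp_space_eq[OF sets_m])
    then show False using V by simp
  qed
  moreover have "clock s' = clock s + ?D"
    unfolding clock_def using s l_mono[of s s'] l_nonneg
    by (subst nn_integral_add[symmetric])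
       (auto intro!: nn_integral_cong simp: ennreal_plus[symmetric] simp del: ennreal_plus)
  ultimately show ?thesis using fin
    by (simp add: ennreal_add_left_cancel_less zero_less_iff_neq_zero)
qed

text \<open>After \<open>T\<close> the path may stay negative for a while; the clock stands still then, so the inverse
  clock at \<open>clock T\<close> jumps to the end of that excursion, where the path is again at 0. Without
  \<open>unb\<close> the infimum could be that of the empty set, a junk value.\<close>

lemma clock_inverse_at_zero:
  assumes T: "0 \<le> T" "b T = 0" and fin: "clock T \<le> ennreal t"
    and unb: "\<And>n. \<exists>s>n. 0 < b s" and t: "0 \<le> t"
  shows "\<exists>u\<ge>0. u \<le> t \<and> b (Inf {s. 0 \<le> s \<and> clock s > ennreal u}) = 0"
proof (intro exI conjI)
  let ?u = "enn2real (clock T)"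
  have lt: "clock T < \<infinity>" using fin by (rule order_le_less_trans) simp
  show "0 \<le> ?u" by simp
  show "?u \<le> t" using fin t by (simp add: enn2real_leI)
  have u: "ennreal ?u = clock T" using lt by simp
  define S where "S = {s. 0 \<le> s \<and> clock s > clock T}"
  obtain v where "T < v" "0 < b v" using unb by auto
  then have "v + 1 \<in> S" using clock_strict[of T v "v + 1"] T lt by (auto simp: S_def)
  then have ne: "S \<noteq> {}" by auto
  have bb: "bdd_below S" by (auto simp: S_def)
  have ge: "T < s" if "s \<in> S" for s
    using that clock_mono[of s T] by (force simp: S_def)
  define \<sigma> where "\<sigma> = Inf S"
  have \<sigma>: "T \<le> \<sigma>" unfolding \<sigma>_def using ge by (intro cInf_greatest[OF ne]) (auto intro: less_imp_le)
  have below: "\<sigma> \<le> s" if "s \<in> S" for s unfolding \<sigma>_def by (rule cInf_lower[OF that bb])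
  have neg: "b r \<le> 0" if r: "T < r" "r < \<sigma>" for r
  proof (rule ccontr)
    assume "\<not> b r \<le> 0"
    then have "(r + \<sigma>) / 2 \<in> S"
      using clock_strict[of T r "(r + \<sigma>) / 2"] T lt r by (auto simp: S_def)
    then show False using below r by force
  qed
  have at: "(b \<longlongrightarrow> b \<sigma>) (at \<sigma> within {0..})"
    using b_cont \<sigma> T by (auto simp: continuous_on_def)
  \<comment> \<open>A positive value would give positive values just before \<sigma>, against
    \<open>neg\<close>. A negative value would persist after \<sigma>, keep the clock constant there
    and push the infimum further right.\<close>
  have "b \<sigma> = 0"
  proof (rule ccontr)
    assume "b \<sigma> \<noteq> 0"
    then consider "0 < b \<sigma>" | "b \<sigma> < 0" by linarith
    then show False
    proof cases
      case 1
      then have "T < \<sigma>" using T \<sigma> by (cases "T = \<sigma>") auto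
      have "\<forall>\<^sub>F r in at \<sigma> within {0..}. 0 < b r" using order_tendstoD(1)[OF at 1] .
      then obtain d where d: "0 < d" "\<And>r. r \<in> {0..} \<Longrightarrow> r \<noteq> \<sigma> \<Longrightarrow> dist r \<sigma> < d \<Longrightarrow> 0 < b r"
        unfolding eventually_at by metis
      have "max T (\<sigma> - d) < \<sigma>" using \<open>T < \<sigma>\<close> d(1) by simp
      then obtain r where "max T (\<sigma> - d) < r" "r < \<sigma>" using dense by blast
      then have r: "T < r" "r < \<sigma>" "dist r \<sigma> < d" by (auto simp: dist_real_def)
      then have "0 < b r" using T r by (intro d(2)) auto
      then show False using neg[of r] r by auto
    next
      case 2
      have "\<forall>\<^sub>F r in at \<sigma> within {0..}. b r < 0" using order_tendstoD(2)[OF at 2] .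
      then obtain d where d: "0 < d" "\<And>r. r \<in> {0..} \<Longrightarrow> r \<noteq> \<sigma> \<Longrightarrow> dist r \<sigma> < d \<Longrightarrow> b r < 0"
        unfolding eventually_at by metis
      have "b r \<le> 0" if "T < r" "r \<le> \<sigma> + d / 2" for r
      proof -
        consider "r < \<sigma>" | "r = \<sigma>" | "\<sigma> < r" by linarith
        then show ?thesis
        proof cases
          case 3
          then show ?thesis using d(2)[of r] d(1) that T by (auto simp: dist_real_def)
        qed (use neg 2 that in auto)
      qed
      then have flat: "clock T = clock (\<sigma> + d / 2)"
        using T \<sigma> d(1) by (intro clock_flat) auto
      have "\<sigma> + d / 2 \<le> s" if s: "s \<in> S" for s
      proof (rule ccontr)
        assume "\<not> ?thesis"
        then have "clock s \<le> clock (\<sigma> + d / 2)" using s by (intro clock_mono) (auto simp: S_def)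
        then show False using flat s by (auto simp: S_def)
      qed
      then have "\<sigma> + d / 2 \<le> \<sigma>" unfolding \<sigma>_def by (rule cInf_greatest[OF ne])
      then show False using d by simp
    qed
  qed
  then show "b (Inf {s. 0 \<le> s \<and> clock s > ennreal ?u}) = 0"
    unfolding u \<sigma>_def S_def .
qed

end

end

section \<open>Local time dominated by occupation on grids\<close>

context local_time_path
begin

text \<open>On the middle half of its support, an interval of length \<open>e\<close>, the tent is
  at least 1/(2e). This crude bound is the origin of the factor 1/2 in front of the local time later
  on.\<close>

lemma tent_occupation_lower:
  assumes T: "0 \<le> T" and e: "0 < e" and c: "0 \<le> c"
    and near: "\<And>z. \<bar>z - y\<bar> \<le> e \<Longrightarrow> c \<le> l z T"
  shows "ennreal (c / 2) \<le> (\<integral>\<^sup>+ r. ennreal (tent e (b r - y)) * indicator {0..T} r \<partial>lborel)"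
proof -
  let ?A = "{y - e / 2..y + e / 2}"
  have "ennreal (c / 2) = (\<integral>\<^sup>+ z. ennreal (c / (2 * e)) * indicator ?A z \<partial>lborel)"
    using c e by (simp add: nn_integral_cmult_indicator ennreal_mult'[symmetric])
  also have "\<dots> \<le> (\<integral>\<^sup>+ z. ennreal (tent e (z - y)) * ennreal (l z T) \<partial>lborel)"
  proof (intro nn_integral_mono)
    fix z
    show "ennreal (c / (2 * e)) * indicator ?A z \<le> ennreal (tent e (z - y)) * ennreal (l z T)"
    proof (cases "z \<in> ?A")
      case True
      then have z: "\<bar>z - y\<bar> \<le> e / 2" by (simp only: atLeastAtMost_iff abs_le_iff) linarith
      have "1 / (2 * e) = (e / 2) / e\<^sup>2" using e by (simp add: power2_eq_square)
      also have "\<dots> \<le> tent e (z - y)"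
        unfolding tent_def using z by (intro divide_right_mono max.coboundedI2) auto
      finally have "1 / (2 * e) * c \<le> tent e (z - y) * l z T"
        using near[of z] z e c by (intro mult_mono) auto
      then show ?thesis using True
        by (simp add: ennreal_mult'[symmetric] ennreal_leI)
    qed simp
  qed
  also have "\<dots> = (\<integral>\<^sup>+ r. ennreal (tent e (b r - y)) * indicator {0..T} r \<partial>lborel)"
    using occupation_formula[OF T, of "\<lambda>z. tent e (z - y)"] by simp
  finally show ?thesis .
qed

text \<open>Before \<open>T\<close> every grid value is positive, so the killed sums contain the
  full Riemann sum on [0, T). Continuity gives pointwise convergence and Fatou's lemma the
  inequality; grid points after \<open>T\<close> can only add to the right-hand side.\<close>

lemma occupation_le_liminf_grid:
  assumes T: "0 \<le> T" and pos: "\<And>r. 0 \<le> r \<Longrightarrow> r < T \<Longrightarrow> 0 < b r"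
  shows "(\<integral>\<^sup>+ r. ennreal (tent (y / (real j + 4)) (b r - y)) * indicator {0..T} r \<partial>lborel)
    \<le> liminf (\<lambda>n. ennreal (grid_occupation b j n y))"
proof -
  let ?f = "\<lambda>v. tent (y / (real j + 4)) (v - y)"
  define \<delta> :: "nat \<Rightarrow> real" where "\<delta> n = (1/16) ^ n" for n
  have \<delta>: "0 < \<delta> n" for n by (simp add: \<delta>_def)
  define c where "c n k = (if survives (\<lambda>k. b (\<delta> n * real k)) (Suc k) then ?f (b (\<delta> n * real k)) else 0)" for n k
  have c0: "0 \<le> c n k" for n k by (simp add: c_def)
  define h where "h n r = (\<Sum>k<32 ^ n. ennreal (c n k) * indicator {\<delta> n * real k..<\<delta> n * real (Suc k)} r)" for n r
  have hint: "(\<integral>\<^sup>+ r. h n r \<partial>lborel) = ennreal (grid_occupation b j n y)" for n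
  proof -
    have "(\<integral>\<^sup>+ r. h n r \<partial>lborel)
        = (\<Sum>k<32 ^ n. \<integral>\<^sup>+ r. ennreal (c n k) * indicator {\<delta> n * real k..<\<delta> n * real (Suc k)} r \<partial>lborel)"
      unfolding h_def by (rule nn_integral_sum) auto
    also have "\<dots> = (\<Sum>k<32 ^ n. ennreal (\<delta> n * c n k))"
    proof (rule sum.cong)
      fix k
      have "emeasure lborel {\<delta> n * real k..<\<delta> n * real (Suc k)} = ennreal (\<delta> n)"
        using \<delta>[of n] by (subst emeasure_lborel_Ico) (auto simp: algebra_simps)
      then show "(\<integral>\<^sup>+ r. ennreal (c n k) * indicator {\<delta> n * real k..<\<delta> n * real (Suc k)} r \<partial>lborel)
          = ennreal (\<delta> n * c n k)"
        using c0[of n k] \<delta>[of n] by (simp add: nn_integral_cmult_indicator ennreal_mult mult.commute)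
    qed simp
    also have "\<dots> = ennreal (\<Sum>k<32 ^ n. \<delta> n * c n k)"
      using \<delta>[of n] c0[of n] by (intro sum_ennreal) auto
    also have "(\<Sum>k<32 ^ n. \<delta> n * c n k) = grid_occupation b j n y"
      unfolding grid_occupation_def occupation_def c_def \<delta>_def by (intro sum.cong) auto
    finally show ?thesis .
  qed
  have ptw: "ennreal (?f (b r)) \<le> liminf (\<lambda>n. h n r)" if r: "0 \<le> r" "r < T" for r
  proof -
    define k where "k n = nat \<lfloor>r / \<delta> n\<rfloor>" for n
    have k: "\<delta> n * real (k n) \<le> r" "r < \<delta> n * real (Suc (k n))" for n
    proof -
      have "real (k n) = of_int \<lfloor>r / \<delta> n\<rfloor>" using r \<delta>[of n] by (simp add: k_def)
      then have "real (k n) \<le> r / \<delta> n" "r / \<delta> n < real (Suc (k n))" by linarith+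
      then show "\<delta> n * real (k n) \<le> r" "r < \<delta> n * real (Suc (k n))"
        using \<delta>[of n] by (auto simp: pos_le_divide_eq pos_divide_less_eq mult.commute)
    qed
    have \<delta>0: "\<delta> \<longlonglongrightarrow> 0" unfolding \<delta>_def by (rule LIMSEQ_power_zero) auto
    have conv: "(\<lambda>n. \<delta> n * real (k n)) \<longlonglongrightarrow> r"
    proof (rule tendsto_sandwich)
      show "\<forall>\<^sub>F n in sequentially. r - \<delta> n \<le> \<delta> n * real (k n)"
        using k(2) by (intro always_eventually allI) (force simp: algebra_simps intro: less_imp_le)
      show "\<forall>\<^sub>F n in sequentially. \<delta> n * real (k n) \<le> r" using k(1) by simp
      show "(\<lambda>n. r - \<delta> n) \<longlonglongrightarrow> r" using tendsto_diff[OF tendsto_const \<delta>0, of r] by simp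
    qed simp
    have "(\<lambda>n. b (\<delta> n * real (k n))) \<longlonglongrightarrow> b r"
      by (rule continuous_on_tendsto_compose[OF b_cont conv])
        (use r less_imp_le[OF \<delta>] in auto)
    then have "(\<lambda>n. ennreal (?f (b (\<delta> n * real (k n))))) \<longlonglongrightarrow> ennreal (?f (b r))"
      unfolding tent_def divide_inverse by (intro tendsto_intros)
    then have "ennreal (?f (b r)) = liminf (\<lambda>n. ennreal (?f (b (\<delta> n * real (k n)))))"
      by (intro lim_imp_Liminf[symmetric]) auto
    also have "\<dots> \<le> liminf (\<lambda>n. h n r)"
    proof (rule Liminf_mono)
      \<comment> \<open>Once the horizon 2^n exceeds \<open>r\<close>, the cell containing
        \<open>r\<close> is among the 32^n cells of the sum.\<close>
      have "filterlim (\<lambda>n. (2::real) ^ n) at_top sequentially" by real_asymp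
      then have "\<forall>\<^sub>F n in sequentially. r < 2 ^ n" by (simp add: filterlim_at_top_dense)
      then show "\<forall>\<^sub>F n in sequentially. ennreal (?f (b (\<delta> n * real (k n)))) \<le> h n r"
      proof eventually_elim
        case (elim n)
        have "\<delta> n * real (32 ^ n) = 2 ^ n"
          by (simp add: \<delta>_def power_mult_distrib[symmetric])
        then have "\<delta> n * real (k n) < \<delta> n * real (32 ^ n)" using k(1)[of n] elim by linarith
        then have kn: "k n < 32 ^ n" using \<delta>[of n] by (simp only: mult_less_cancel_left_pos of_nat_less_iff)
        have "survives (\<lambda>k. b (\<delta> n * real k)) (Suc (k n))"
          unfolding survives_def
        proof
          fix i assume "i \<in> {..<Suc (k n)}"
          then have "\<delta> n * real i \<le> \<delta> n * real (k n)" using \<delta>[of n] by (intro mult_left_mono) auto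
          then show "0 < b (\<delta> n * real i)" using k(1)[of n] r \<delta>[of n]
            by (intro pos mult_nonneg_nonneg; linarith)
        qed
        then have "ennreal (?f (b (\<delta> n * real (k n))))
            = ennreal (c n (k n)) * indicator {\<delta> n * real (k n)..<\<delta> n * real (Suc (k n))} r"
          using k[of n] by (simp add: c_def)
        also have "\<dots> \<le> h n r"
          unfolding h_def using kn by (intro member_le_sum) auto
        finally show ?case .
      qed
    qed
    finally show ?thesis .
  qed
  have "(\<integral>\<^sup>+ r. ennreal (?f (b r)) * indicator {0..T} r \<partial>lborel) \<le> (\<integral>\<^sup>+ r. liminf (\<lambda>n. h n r) \<partial>lborel)"
  proof (rule nn_integral_mono_AE)
    show "AE r in lborel. ennreal (?f (b r)) * indicator {0..T} r \<le> liminf (\<lambda>n. h n r)"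
      using AE_lborel_singleton[of T]
      by eventually_elim (use ptw in \<open>auto simp: indicator_def\<close>)
  qed
  also have "\<dots> \<le> liminf (\<lambda>n. \<integral>\<^sup>+ r. h n r \<partial>lborel)"
    unfolding h_def by (intro nn_integral_liminf) measurable
  finally show ?thesis unfolding hint .
qed

text \<open>Passing through a liminf needs strict inequalities, so the bound is shown for every
  \<open>a\<close> strictly below half the local time, and \<open>a\<close> then increases to it
  along n/(n + 1).\<close>

lemma local_time_power_le_local_moment:
  assumes T: "0 \<le> T" and pos: "\<And>r. 0 \<le> r \<Longrightarrow> r < T \<Longrightarrow> 0 < b r" and y: "0 < y" and p: "0 < p"
  shows "ennreal ((l y T / 2) ^ p) \<le> local_moment b p y"
proof -
  have below: "ennreal (a ^ p) \<le> local_moment b p y" if a: "0 \<le> a" "2 * a < l y T" for a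
  proof -
    obtain c where c: "2 * a < c" "c < l y T" using a dense by blast
    have "\<forall>\<^sub>F z in at y. c < l z T"
      using l_cont_space[OF T] c(2) by (auto simp: continuous_on_def intro: order_tendstoD)
    then obtain d where d: "0 < d" "\<And>z. z \<noteq> y \<Longrightarrow> dist z y < d \<Longrightarrow> c < l z T"
      unfolding eventually_at by auto
    have d': "c \<le> l z T" if "\<bar>z - y\<bar> < d" for z
      using d(2)[of z] that c(2) by (cases "z = y") (auto simp: dist_real_def)
    have "(\<lambda>j. y / (real j + 4)) \<longlonglongrightarrow> 0" by real_asymp
    then have "\<forall>\<^sub>F j in sequentially. y / (real j + 4) < d" using d(1) by (rule order_tendstoD)
    then have "\<forall>\<^sub>F j in sequentially. ennreal (a ^ p) \<le> liminf (\<lambda>n. ennreal (grid_occupation b j n y ^ p))"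
    proof eventually_elim
      case (elim j)
      have "ennreal a < ennreal (c / 2)" using a c by (intro ennreal_lessI) auto
      also have "\<dots> \<le> (\<integral>\<^sup>+ r. ennreal (tent (y / (real j + 4)) (b r - y)) * indicator {0..T} r \<partial>lborel)"
        using y a c elim by (intro tent_occupation_lower T d') auto
      also have "\<dots> \<le> liminf (\<lambda>n. ennreal (grid_occupation b j n y))"
        by (rule occupation_le_liminf_grid[OF T pos])
      finally have "\<forall>\<^sub>F n in sequentially. ennreal a < ennreal (grid_occupation b j n y)"
        by (rule less_LiminfD)
      then have "\<forall>\<^sub>F n in sequentially. ennreal (a ^ p) \<le> ennreal (grid_occupation b j n y ^ p)"
      proof eventually_elim
        case (elim n)
        then have "a < grid_occupation b j n y" using a by (simp add: ennreal_less_iff)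
        then show ?case using a by (intro ennreal_leI power_mono) auto
      qed
      then show ?case by (rule Liminf_bounded)
    qed
    then show ?thesis unfolding local_moment_def by (rule Liminf_bounded)
  qed
  show ?thesis
  proof (cases "l y T = 0")
    case True
    then show ?thesis using p by (simp add: zero_power)
  next
    case False
    then have l: "0 < l y T" using l_nonneg[of y T] by simp
    show ?thesis
    proof (rule LIMSEQ_le_const2)
      have "(\<lambda>n. ennreal ((l y T / 2 * (real n / real (Suc n))) ^ p)) \<longlonglongrightarrow> ennreal ((l y T / 2 * 1) ^ p)"
        by (intro tendsto_intros LIMSEQ_n_over_Suc_n)
      then show "(\<lambda>n. ennreal ((l y T / 2 * (real n / real (Suc n))) ^ p)) \<longlonglongrightarrow> ennreal ((l y T / 2) ^ p)"
        by simp
      have "2 * (l y T / 2 * (real n / real (Suc n))) < l y T" for n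
      proof -
        have "real n / real (Suc n) < 1" by simp
        then have "l y T * (real n / real (Suc n)) < l y T * 1" using l by (intro mult_strict_left_mono)
        moreover have "2 * (l y T / 2 * q) = l y T * q" for q by simp
        ultimately show ?thesis by (simp only: mult_1_right)
      qed
      then show "\<exists>N. \<forall>n\<ge>N. ennreal ((l y T / 2 * (real n / real (Suc n))) ^ p) \<le> local_moment b p y"
        using l by (intro exI[of _ 0] allI impI below) (auto intro!: mult_nonneg_nonneg)
    qed
  qed
qed

end

section \<open>Oscillation of Brownian motion\<close>

lemma gaussian_tail_pos: "0 < measure (gaussian 1) {2<..}"
proof -
  interpret prob_space "gaussian 1" using prob_space_normal_density[of "sqrt 1" 0] by simp
  have "emeasure (gaussian 1) {2<..} \<noteq> 0"
  proof
    assume "emeasure (gaussian 1) {2<..} = 0"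
    then have "(\<integral>\<^sup>+ u. ennreal (normal_density 0 (sqrt 1) u) * indicator {2<..} u \<partial>lborel) = 0"
      by (subst (asm) emeasure_density) auto
    then have "AE u in lborel. ennreal (normal_density 0 (sqrt 1) u) * indicator {2<..} u = 0"
      by (subst (asm) nn_integral_0_iff_AE) auto
    then have "AE u in lborel. u \<notin> {2<..3::real}"
      by eventually_elim (auto simp: normal_density_def indicator_def)
    then have "emeasure lborel {2<..3::real} = 0"
      by (subst (asm) AE_iff_measurable[of "{2<..3}"]) auto
    then show False by simp
  qed
  then show ?thesis by (metis emeasure_eq_measure ennreal_0 zero_less_measure_iff)
qed

text \<open>Rescaling to the standard Gaussian bounds all these probabilities below by the same
  number, as the divergence argument for independent events requires.\<close>

lemma normal_tail:
  assumes "prob_space M" and X: "distributed M lborel X (normal_density 0 \<sigma>)" and \<sigma>: "0 < \<sigma>" and a: "a \<le> 2 * \<sigma>"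
  shows "measure (gaussian 1) {2<..} \<le> measure M {\<omega> \<in> space M. a < X \<omega>}"
proof -
  interpret prob_space M by fact
  have D: "distributed M lborel (\<lambda>\<omega>. X \<omega> / \<sigma>) (normal_density 0 1)"
    using normal_density_affine[OF X \<sigma>, of "inverse \<sigma>" 0] \<sigma> by (simp add: divide_inverse mult.commute)
  have Dm: "(\<lambda>\<omega>. X \<omega> / \<sigma>) \<in> measurable M lborel" using D by (simp add: distributed_def)
  have [measurable]: "X \<in> borel_measurable M" using X by (simp add: distributed_def)
  have "measure (gaussian 1) {2<..} = measure (distr M lborel (\<lambda>\<omega>. X \<omega> / \<sigma>)) {2<..}"
    using D by (simp add: distributed_def)
  also have "\<dots> = measure M ((\<lambda>\<omega>. X \<omega> / \<sigma>) -` {2<..} \<inter> space M)"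
    by (rule measure_distr[OF Dm]) simp
  also have "\<dots> \<le> measure M {\<omega> \<in> space M. a < X \<omega>}"
    using \<sigma> a by (intro finite_measure_mono) (auto simp: pos_less_divide_eq)
  finally show ?thesis .
qed

lemma normal_Chebyshev:
  assumes "prob_space M" and X: "distributed M lborel X (normal_density 0 \<sigma>)" and \<sigma>: "0 < \<sigma>" and a: "0 < a"
  shows "measure M {\<omega> \<in> space M. a \<le> \<bar>X \<omega>\<bar>} \<le> \<sigma>\<^sup>2 / a\<^sup>2"
proof -
  interpret prob_space M by fact
  have [measurable]: "X \<in> borel_measurable M" using X by (simp add: distributed_def)
  have E: "expectation X = 0" and V: "variance X = \<sigma>\<^sup>2"
    using normal_distributed_expectation[OF \<sigma> X] normal_distributed_variance[OF \<sigma> X] by auto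
  have "integrable M (\<lambda>\<omega>. X \<omega> ^ 2)"
  proof -
    have "integrable lborel (\<lambda>x. normal_density 0 \<sigma> x * (x - 0) ^ 2)"
      by (rule integrable_normal_moment[OF \<sigma>])
    then show ?thesis by (subst distributed_integrable[OF X, symmetric]) auto
  qed
  then show ?thesis using Chebyshev_inequality[of X a] a by (simp add: E V[unfolded E, simplified])
qed

text \<open>The divergent half of Borel-Cantelli in a uniform case: failing at \<open>n\<close>
  consecutive independent trials has probability at most (1 - p)^n.\<close>

lemma infinitely_often_large:
  assumes "prob_space M" and meas: "\<And>i. X i \<in> borel_measurable M"
    and ind: "\<And>k n. prob_space.indep_vars M (\<lambda>_. borel) (\<lambda>i. X (k + i)) {..<n::nat}"
    and pr: "\<And>i. p \<le> measure M {\<omega> \<in> space M. a i < (X i \<omega> :: real)}" and p: "0 < p"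
  shows "AE \<omega> in M. \<forall>k::nat. \<exists>i\<ge>k. a i < X i \<omega>"
proof -
  interpret prob_space M by fact
  note [measurable] = meas
  have p1: "p \<le> 1" using order_trans[OF pr prob_le_1] .
  have "AE \<omega> in M. \<exists>i\<ge>k. a i < X i \<omega>" for k
  proof -
    let ?N = "{\<omega> \<in> space M. \<forall>i\<ge>k. X i \<omega> \<le> a i}"
    have le: "measure M ?N \<le> (1 - p) ^ n" if n: "0 < n" for n
    proof -
      let ?S = "\<lambda>i. X (k + i) -` {..a (k + i)} \<inter> space M"
      have "measure M ?N \<le> measure M (\<Inter>i\<in>{..<n}. ?S i)"
        using n by (intro finite_measure_mono) auto
      also have "\<dots> = (\<Prod>i<n. measure M (?S i))"
        using n by (intro indep_varsD_finite[OF ind]) auto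
      also have "\<dots> \<le> (\<Prod>i<n. 1 - p)"
      proof (rule prod_mono)
        fix i
        have "?S i = space M - {\<omega> \<in> space M. a (k + i) < X (k + i) \<omega>}" by auto
        then have "measure M (?S i) = 1 - measure M {\<omega> \<in> space M. a (k + i) < X (k + i) \<omega>}"
          by (simp add: prob_compl)
        then show "0 \<le> measure M (?S i) \<and> measure M (?S i) \<le> 1 - p" using pr[of "k + i"] by simp
      qed
      finally show ?thesis by simp
    qed
    have "measure M ?N \<le> 0"
    proof (rule LIMSEQ_le_const)
      show "(\<lambda>n. (1 - p) ^ n) \<longlonglongrightarrow> 0" using p p1 by (intro LIMSEQ_power_zero) auto
      show "\<exists>N. \<forall>n\<ge>N. measure M ?N \<le> (1 - p) ^ n" using le by (intro exI[of _ 1]) auto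
    qed
    then have "measure M ?N = 0" by (simp add: measure_le_0_iff)
    then have "AE \<omega> in M. \<omega> \<notin> ?N" by (intro AE_I'[of ?N]) (auto simp: null_sets_def emeasure_eq_measure)
    with AE_space show ?thesis by eventually_elim (auto simp: not_le)
  qed
  then show ?thesis by (simp add: AE_all_countable)
qed

text \<open>Along the times \<open>(i!)\<^sup>2\<close> the last increment is so large compared with
  the current position that its sign decides the sign of the next position infinitely often.\<close>

lemma brownian_oscillates:
  assumes bm: "brownian_motion_from M x B" and sgn: "c = 1 \<or> c = -1"
  shows "AE \<omega> in M. \<forall>K. \<exists>s>K. 0 < c * B s \<omega>"
proof -
  have ps: "prob_space M" using bm by (simp add: brownian_motion_from_def)
  interpret prob_space M by fact
  define t :: "nat \<Rightarrow> real" where "t i = (fact i)\<^sup>2" for i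
  have t0: "0 < t i" for i by (simp add: t_def)
  have [measurable]: "B (t i) \<in> borel_measurable M" "B 0 \<in> borel_measurable M" for i
    using bm t0[of i] by (auto simp: brownian_motion_from_def)
  have tS: "t (Suc i) = (real i + 1)\<^sup>2 * t i" for i by (simp only: t_def fact_Suc power_mult_distrib of_nat_Suc add.commute)
  have tm: "t (Suc i) < t (Suc (Suc i))" for i
  proof -
    have "1 * t (Suc i) < (real (Suc i) + 1)\<^sup>2 * t (Suc i)"
      using t0[of "Suc i"] by (intro mult_strict_right_mono one_less_power) auto
    then show ?thesis by (simp only: tS[of "Suc i"] mult_1_left)
  qed
  have incr: "distributed M lborel (\<lambda>\<omega>. B v \<omega> - B s \<omega>) (normal_density 0 (sqrt (v - s)))"
    if "0 \<le> s" "s < v" for s v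
    using bm that by (simp add: brownian_motion_from_def)
  define X where "X i \<omega> = c * (B (t (Suc (Suc i))) \<omega> - B (t (Suc i)) \<omega>)" for i \<omega>
  \<comment> \<open>This equals (i + 1) (i + 1)! + (i + 1)!. The first summand beats the
    displacement accumulated by time \<open>t (Suc i)\<close>, the second the starting
    point.\<close>
  define a :: "nat \<Rightarrow> real" where "a i = (real i + 2) * fact (Suc i)" for i
  have Xm[measurable]: "X i \<in> borel_measurable M" for i
    unfolding X_def by measurable
  have ind: "indep_vars (\<lambda>_. borel) (\<lambda>i. X (k + i)) {..<n}" for k n
  proof -
    have "indep_vars (\<lambda>_. borel) (\<lambda>i \<omega>. B (t (Suc (k + Suc i))) \<omega> - B (t (Suc (k + i))) \<omega>) {..<n}"
    proof -
      have "0 \<le> t (Suc (k + 0)) \<and> (\<forall>i<n. t (Suc (k + i)) < t (Suc (k + Suc i)))"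
        using tm t0[of "Suc k"] by (simp add: less_imp_le)
      with bm show ?thesis
        unfolding brownian_motion_from_def by (elim conjE allE[of _ n] allE[of _ "\<lambda>i. t (Suc (k + i))"]) (simp add: tm)
    qed
    then have "indep_vars (\<lambda>_. borel) (\<lambda>i. (\<lambda>u. c * u) \<circ> (\<lambda>\<omega>. B (t (Suc (k + Suc i))) \<omega> - B (t (Suc (k + i))) \<omega>)) {..<n}"
      by (rule indep_vars_compose) auto
    then show ?thesis by (simp add: X_def[abs_def] comp_def)
  qed
  have big: "AE \<omega> in M. \<forall>k::nat. \<exists>i\<ge>k. a i < X i \<omega>"
  proof (rule infinitely_often_large[OF ps Xm ind _ gaussian_tail_pos])
    fix i
    let ?s = "sqrt (t (Suc (Suc i)) - t (Suc i))"
    have s: "0 < ?s" using tm[of i] by simp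
    have D: "distributed M lborel (X i) (normal_density 0 ?s)"
      using normal_density_affine[OF incr[of "t (Suc i)" "t (Suc (Suc i))"], of c 0] sgn s tm[of i] t0[of "Suc i"]
      by (auto simp: X_def[abs_def])
    have "(a i)\<^sup>2 \<le> (2 * ?s)\<^sup>2"
    proof -
      have "(real i + 2)\<^sup>2 * t (Suc i) \<le> 4 * ((real (Suc i) + 1)\<^sup>2 - 1) * t (Suc i)"
        using t0[of "Suc i"] by (intro mult_right_mono) (auto simp: power2_eq_square algebra_simps)
      moreover have "(2 * ?s)\<^sup>2 = 4 * (t (Suc (Suc i)) - t (Suc i))"
        using tm[of i] by (simp add: power_mult_distrib)
      moreover have "(a i)\<^sup>2 = (real i + 2)\<^sup>2 * t (Suc i)" by (simp add: a_def t_def power_mult_distrib)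
      ultimately show ?thesis by (simp add: tS[of "Suc i"] algebra_simps)
    qed
    moreover have "0 \<le> 2 * ?s" using s by linarith
    ultimately have "a i \<le> 2 * ?s" by (rule power2_le_imp_le)
    then show "measure (gaussian 1) {2<..} \<le> measure M {\<omega> \<in> space M. a i < X i \<omega>}"
      by (rule normal_tail[OF ps D s])
  qed
  \<comment> \<open>The standard deviation of the displacement is (i + 1)!, so Chebyshev bounds the
    probability by (i + 1)^(-2), which is summable: almost surely only finitely many
    \<open>A i\<close> occur.\<close>
  define A where "A i = {\<omega> \<in> space M. (real i + 1) * fact (Suc i) \<le> \<bar>B (t (Suc i)) \<omega> - B 0 \<omega>\<bar>}" for i
  have Am[measurable]: "A i \<in> sets M" for i
    unfolding A_def by measurable
  have Ab: "measure M (A i) \<le> 1 / (real i + 1)\<^sup>2" for i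
  proof -
    have "measure M (A i) \<le> (sqrt (t (Suc i) - 0))\<^sup>2 / ((real i + 1) * fact (Suc i))\<^sup>2"
      unfolding A_def using t0[of "Suc i"]
      by (intro normal_Chebyshev[OF ps] incr) auto
    also have "\<dots> = 1 / (real i + 1)\<^sup>2"
      by (simp add: t_def power_mult_distrib)
    finally show ?thesis .
  qed
  have "AE \<omega> in M. \<forall>\<^sub>F i in sequentially. \<omega> \<in> space M - A i"
  proof (rule borel_cantelli_AE1)
    show "summable (\<lambda>i. measure M (A i))"
    proof (rule summable_comparison_test'[where g="\<lambda>i. inverse ((real i + 1)\<^sup>2)" and N=0])
      have "summable (\<lambda>i. inverse (real (Suc i) ^ 2))"
        using inverse_power_summable[of 2] by (subst summable_Suc_iff) auto
      then show "summable (\<lambda>i. inverse ((real i + 1)\<^sup>2))" by (simp add: add.commute)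
    qed (use Ab in \<open>simp add: inverse_eq_divide\<close>)
  qed (auto simp: emeasure_eq_measure)
  moreover have "AE \<omega> in M. B 0 \<omega> = x" using bm by (simp add: brownian_motion_from_def)
  ultimately show ?thesis using big
  proof eventually_elim
    case (elim \<omega>)
    show ?case
    proof
      fix K :: real
      obtain N where N: "\<And>i. N \<le> i \<Longrightarrow> \<omega> \<in> space M - A i"
        using elim(1) unfolding eventually_sequentially by auto
      obtain n :: nat where n: "\<bar>x\<bar> + \<bar>K\<bar> \<le> real n" using real_arch_simple by blast
      obtain i where i: "max N n \<le> i" "a i < X i \<omega>" using elim(3) by blast
      have ix: "\<bar>x\<bar> + \<bar>K\<bar> \<le> real i"
        using i(1) by (intro order_trans[OF n]) simp
      have f: "real i + 1 \<le> fact (Suc i)"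
      proof -
        have "real (Suc i) \<le> real (fact (Suc i))" by (simp only: of_nat_le_iff fact_ge_self)
        then show ?thesis by (simp only: of_nat_fact of_nat_Suc add.commute)
      qed
      have "\<bar>B (t (Suc i)) \<omega> - x\<bar> < (real i + 1) * fact (Suc i)"
        using N[of i] i(1) elim(2) by (auto simp: A_def)
      then have "\<bar>c * B (t (Suc i)) \<omega> - c * x\<bar> < (real i + 1) * fact (Suc i)"
        using sgn by auto
      moreover have "\<bar>c * x\<bar> \<le> real i" using sgn ix by auto
      moreover have "a i = (real i + 1) * fact (Suc i) + fact (Suc i)" by (simp add: a_def algebra_simps)
      ultimately have "0 < c * B (t (Suc (Suc i))) \<omega>"
        using i(2) f unfolding X_def by (simp only: right_diff_distrib)
      moreover have "K < t (Suc (Suc i))"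
      proof -
        have "K < real i + 1" using ix by linarith
        also have "\<dots> \<le> fact (Suc i) ^ 1" using f by simp
        also have "\<dots> \<le> fact (Suc i) ^ 2" by (rule power_increasing[OF _ fact_ge_1]) simp
        also have "\<dots> < t (Suc (Suc i))" using tm[of i] by (simp add: t_def)
        finally show ?thesis .
      qed
      ultimately show "\<exists>s>K. 0 < c * B s \<omega>" by blast
    qed
  qed
qed

section \<open>Integration against the speed measure\<close>

lemma speed_measure_sigma_finite:
  assumes m: "speed_measure m"
  shows "sigma_finite_measure m"
proof
  have sm: "sets m = sets borel" using m by (simp add: speed_measure_def)
  let ?A = "insert {..0} (range (\<lambda>n. {1 / (real n + 1)..real n}))"
  show "\<exists>A. countable A \<and> A \<subseteq> sets m \<and> \<Union> A = space m \<and> (\<forall>a\<in>A. emeasure m a \<noteq> \<infinity>)"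
  proof (intro exI[of _ ?A] conjI ballI)
    show "?A \<subseteq> sets m" by (auto simp: sm)
    have "\<exists>n. 1 / (real n + 1) \<le> y \<and> y \<le> real n" if y: "0 < y" for y
    proof -
      obtain n where n: "max y (1 / y) \<le> real n" using real_arch_simple by blast
      then have "1 \<le> y * real n" using y by (simp add: divide_le_eq mult.commute)
      then have "1 \<le> y * (real n + 1)" using y by (simp add: distrib_left)
      then show ?thesis using n by (intro exI[of _ n]) (auto simp: divide_le_eq)
    qed
    then have "\<Union> ?A = UNIV" by (auto simp: not_le) (metis not_le)
    then show "\<Union> ?A = space m" using sets_eq_imp_space_eq[OF sm] by simp
    fix a assume "a \<in> ?A"
    then show "emeasure m a \<noteq> \<infinity>"
    proof
      assume "a = {..0}"
      then show ?thesis using m by (simp add: speed_measure_def)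
    next
      assume "a \<in> range (\<lambda>n. {1 / (real n + 1)..real n})"
      then obtain n where "a = {1 / (real n + 1)..real n}" by auto
      moreover have "0 < y" if "1 / (real n + 1) \<le> y" for y
        by (rule less_le_trans[OF _ that]) simp
      ultimately have "compact a" "a \<subseteq> {0<..}" by auto
      then have "emeasure m a < \<infinity>" using m unfolding speed_measure_def by blast
      then show ?thesis by simp
    qed
  qed simp
qed

text \<open>Dyadic decomposition near 0. For y between 2^(-k-2) and 2^(-k-1) the factor
  y^(-\<alpha>) is at most 2^(\<alpha>(k+2)), while \<open>Ibound\<close> at 2^(-k-1) gives C
  2^(-\<rho>(k+1)). The product is geometric with ratio 2^(\<alpha>-\<rho>) < 1.\<close>

lemma weight_integral_finite:
  fixes m :: "real measure" and C \<rho> :: real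
  assumes sm: "sets m = sets borel"
    and cdi: "(\<integral>\<^sup>+ y. ennreal y * indicator {1..} y \<partial>m) < \<infinity>"
    and hits0: "(\<integral>\<^sup>+ y. ennreal y * indicator {0<..<1} y \<partial>m) < \<infinity>"
    and Cpos: "C > 0"
    and Ibound: "\<And>x. 0 < x \<Longrightarrow> x < 1 \<Longrightarrow>
                   (\<integral>\<^sup>+ y. ennreal y * indicator {0<..x} y \<partial>m) \<le> ennreal (C * x powr \<rho>)"
    and \<alpha>: "0 \<le> \<alpha>" "\<alpha> < \<rho>" "\<alpha> \<le> 1"
  shows "(\<integral>\<^sup>+ y. ennreal (y powr (1 - \<alpha>)) * indicator {0<..} y \<partial>m) < \<infinity>"
proof -
  note [measurable_cong] = sm
  define q where "q = (2::real) powr (\<alpha> - \<rho>)"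
  have q: "0 < q" "q < 1" using \<alpha> by (auto simp: q_def powr_less_one)
  let ?g = "\<lambda>k y. ennreal (2 powr (\<alpha> * real (k + 2))) * (ennreal y * indicator {0<..(1/2) ^ (k + 1)} y)"
  have split: "ennreal (y powr (1 - \<alpha>)) * indicator {0<..} y
      \<le> ennreal y * indicator {1..} y + ennreal 2 * (ennreal y * indicator {0<..<1} y) + (\<Sum>k. ?g k y)" for y
  proof -
    consider "y \<le> 0" | "1 \<le> y" | "1/2 < y" "y < 1" | "0 < y" "y \<le> 1/2" by linarith
    then show ?thesis
    proof cases
      case 1
      then show ?thesis by simp
    next
      case 2
      then have "y powr (1 - \<alpha>) \<le> y powr 1" using \<alpha> by (intro powr_mono) auto
      then have "ennreal (y powr (1 - \<alpha>)) \<le> ennreal y" using 2 by (intro ennreal_leI) auto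
      then show ?thesis using 2 by (simp add: add_increasing2)
    next
      \<comment> \<open>\<open>Ibound\<close> stops short of x = 1, so the dyadic pieces start at
        1/2; on (1/2, 1) the weight is at most 1 < 2y.\<close>
      case 3
      then have "y powr (1 - \<alpha>) \<le> 1" using \<alpha> by (intro powr_le1) auto
      then have "ennreal (y powr (1 - \<alpha>)) \<le> ennreal (2 * y)" using 3 by (intro ennreal_leI) auto
      then show ?thesis using 3 by (simp add: ennreal_mult' add_increasing2)
    next
      case 4
      define k where "k = nat \<lfloor>log 2 (1 / y)\<rfloor> - 1"
      have l1: "1 \<le> log 2 (1 / y)" using 4 by (subst le_log_iff) (auto simp: field_simps)
      then have kf: "real (k + 1) = of_int \<lfloor>log 2 (1 / y)\<rfloor>"
        unfolding k_def by (simp add: of_nat_diff le_nat_floor)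
      have "real (k + 1) \<le> log 2 (1 / y)" "log 2 (1 / y) < real (k + 2)"
        using kf by linarith+
      then have kp: "2 powr real (k + 1) \<le> 1 / y" "1 / y < 2 powr real (k + 2)"
        using 4 by (simp_all add: le_log_iff log_less_iff del: of_nat_add)
      have up: "y \<le> (1/2) ^ (k + 1)"
        using kp(1) 4 by (simp add: powr_realpow power_divide field_simps del: of_nat_add of_nat_Suc power_Suc)
      have "y powr (1 - \<alpha>) = (1 / y) powr \<alpha> * y"
        using 4 by (simp add: powr_diff powr_divide)
      also have "\<dots> \<le> (2 powr real (k + 2)) powr \<alpha> * y"
        using kp(2) 4 \<alpha> by (intro mult_right_mono powr_mono2) auto
      also have "\<dots> = 2 powr (\<alpha> * real (k + 2)) * y" by (simp only: powr_powr mult.commute)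
      finally have "ennreal (y powr (1 - \<alpha>)) \<le> ennreal (2 powr (\<alpha> * real (k + 2)) * y)" by (rule ennreal_leI)
      also have "\<dots> = ?g k y" using 4 up by (simp add: ennreal_mult')
      also have "\<dots> \<le> (\<Sum>k. ?g k y)"
        using sum_le_suminf[of "\<lambda>k. ?g k y" "{k}"] by simp
      finally show ?thesis using 4 by (simp add: add_increasing)
    qed
  qed
  have "(\<integral>\<^sup>+ y. (\<Sum>k. ?g k y) \<partial>m) = (\<Sum>k. \<integral>\<^sup>+ y. ?g k y \<partial>m)"
    by (intro nn_integral_suminf) measurable
  also have "\<dots> \<le> (\<Sum>k. ennreal (2 powr (2 * \<alpha> - \<rho>) * C * q ^ k))"
  proof (intro suminf_le)
    fix k
    have x: "(1/2::real) ^ (k + 1) < 1" by (intro power_Suc_less_one[where n=k, simplified Suc_eq_plus1]) auto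
    have "(\<integral>\<^sup>+ y. ?g k y \<partial>m) = ennreal (2 powr (\<alpha> * real (k + 2)))
        * (\<integral>\<^sup>+ y. ennreal y * indicator {0<..(1/2) ^ (k + 1)} y \<partial>m)"
      by (intro nn_integral_cmult) measurable
    also have "\<dots> \<le> ennreal (2 powr (\<alpha> * real (k + 2))) * ennreal (C * ((1/2) ^ (k + 1)) powr \<rho>)"
      using x by (intro mult_left_mono Ibound) auto
    also have "\<dots> = ennreal (2 powr (2 * \<alpha> - \<rho>) * C * q ^ k)"
    proof -
      have "((1/2::real) ^ (k + 1)) powr \<rho> = 2 powr (- (real (k + 1) * \<rho>))"
      proof -
        have "(1/2::real) ^ (k + 1) = 2 powr (- real (k + 1))"
          by (simp add: powr_minus powr_realpow power_divide inverse_eq_divide del: of_nat_add of_nat_Suc power_Suc)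
        then show ?thesis by (simp only: powr_powr minus_mult_left)
      qed
      moreover have "q ^ k = 2 powr ((\<alpha> - \<rho>) * real k)"
        unfolding q_def by (simp add: powr_realpow[symmetric] powr_powr)
      ultimately have "2 powr (\<alpha> * real (k + 2)) * (C * ((1/2) ^ (k + 1)) powr \<rho>)
          = 2 powr (2 * \<alpha> - \<rho>) * C * q ^ k"
        by (simp add: powr_add[symmetric] algebra_simps)
      then show ?thesis by (subst ennreal_mult'[symmetric]) (simp, simp only:)
    qed
    finally show "(\<integral>\<^sup>+ y. ?g k y \<partial>m) \<le> ennreal (2 powr (2 * \<alpha> - \<rho>) * C * q ^ k)" .
  qed auto
  also have "\<dots> < \<infinity>"
  proof -
    have "summable (\<lambda>k. 2 powr (2 * \<alpha> - \<rho>) * C * q ^ k)"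
      using q by (intro summable_mult summable_geometric) auto
    then show ?thesis using Cpos q by (subst suminf_ennreal2) auto
  qed
  finally have tail: "(\<integral>\<^sup>+ y. (\<Sum>k. ?g k y) \<partial>m) < \<infinity>" .
  have "(\<integral>\<^sup>+ y. ennreal (y powr (1 - \<alpha>)) * indicator {0<..} y \<partial>m)
      \<le> (\<integral>\<^sup>+ y. ennreal y * indicator {1..} y + ennreal 2 * (ennreal y * indicator {0<..<1} y) + (\<Sum>k. ?g k y) \<partial>m)"
    by (intro nn_integral_mono split)
  also have "\<dots> = (\<integral>\<^sup>+ y. ennreal y * indicator {1..} y \<partial>m)
      + ennreal 2 * (\<integral>\<^sup>+ y. ennreal y * indicator {0<..<1} y \<partial>m) + (\<integral>\<^sup>+ y. (\<Sum>k. ?g k y) \<partial>m)"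
    by (subst nn_integral_add; measurable?)+ (simp add: nn_integral_cmult nn_integral_add)
  also have "\<dots> < \<infinity>" using cdi hits0 tail by (simp add: ennreal_mult_less_top)
  finally show ?thesis .
qed

section \<open>From moments at each level to a bound on the clock\<close>

lemma le_threshold_plus_power:
  fixes u w a :: real
  assumes u: "0 \<le> u" and w: "0 < w" and a: "0 < a" and p: "0 < p"
  shows "u \<le> a * w + 2 ^ p / a ^ (p - 1) * (1 / w ^ (p - 1) * (u / 2) ^ p)"
proof (cases "u \<le> a * w")
  case True
  have "0 \<le> 2 ^ p / a ^ (p - 1) * (1 / w ^ (p - 1) * (u / 2) ^ p)" using u w a by simp
  then show ?thesis using True by linarith
next
  case False
  \<comment> \<open>Above the threshold the ratio exceeds 1, so multiplying by its power
    \<open>p - 1\<close> only increases.\<close>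
  have "1 \<le> (u / (a * w)) ^ (p - 1)" using False w a by (intro one_le_power) simp
  then have "u * 1 \<le> u * (u / (a * w)) ^ (p - 1)" using u by (intro mult_left_mono) auto
  also have "\<dots> = u ^ p / (a ^ (p - 1) * w ^ (p - 1))"
    by (simp add: power_divide power_mult_distrib power_minus_mult[OF p, symmetric] mult.commute)
  also have "\<dots> = 2 ^ p / a ^ (p - 1) * (1 / w ^ (p - 1) * (u / 2) ^ p)"
    by (simp add: power_divide)
  finally have "u \<le> 2 ^ p / a ^ (p - 1) * (1 / w ^ (p - 1) * (u / 2) ^ p)" by simp
  moreover have "0 \<le> a * w" using a w by simp
  ultimately show ?thesis by linarith
qed

text \<open>With w(y) = y^(1-1/p), the integral of w^(1-p) times \<open>local_moment\<close>. It is
  the measurable random variable to which Markov's inequality is applied.\<close>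

definition weighted_moment :: "real measure \<Rightarrow> nat \<Rightarrow> (real \<Rightarrow> real) \<Rightarrow> ennreal" where
  "weighted_moment m p b = (\<integral>\<^sup>+ y. ennreal (1 / (y powr (1 - 1 / real p)) ^ (p - 1)) * local_moment b p y * indicator {0<..} y \<partial>m)"

lemma weighted_moment_measurable:
  assumes bm: "brownian_motion_from M x B" and m: "speed_measure m"
  shows "(\<lambda>z. ennreal (1 / (fst z powr (1 - 1 / real p)) ^ (p - 1)) * local_moment (\<lambda>s. B s (snd z)) p (fst z)
      * indicator {0<..} (fst z)) \<in> borel_measurable (m \<Otimes>\<^sub>M M)"
proof -
  have sm: "sets m = sets borel" using m by (simp add: speed_measure_def)
  have "B s \<in> borel_measurable M" if "0 \<le> s" for s
    using bm that by (simp add: brownian_motion_from_def)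
  note [measurable] = local_moment_measurable[OF this]
  have "(\<lambda>z. ennreal (1 / (fst z powr (1 - 1 / real p)) ^ (p - 1)) * local_moment (\<lambda>s. B s (snd z)) p (fst z)
      * indicator {0<..} (fst z)) \<in> borel_measurable (borel \<Otimes>\<^sub>M M)" by measurable
  moreover have "sets (m \<Otimes>\<^sub>M M) = sets (borel \<Otimes>\<^sub>M M)" by (intro sets_pair_measure_cong sm refl)
  ultimately show ?thesis using measurable_cong_sets by blast
qed

text \<open>Tonelli, then the moment bound level by level. The weight is chosen so that w^p =
  y^(p-1), whence w^(1-p) y^(p-1) = w: both halves of the threshold bound lead to the same integral
  of w.\<close>

lemma weighted_moment_expectation:
  assumes bm: "brownian_motion_from M x B" and m: "speed_measure m" and x: "0 < x" and p: "0 < p"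
  shows "(\<integral>\<^sup>+ \<omega>. weighted_moment m p (\<lambda>s. B s \<omega>) \<partial>M)
    \<le> ennreal (fact p * 5 ^ p * x) * (\<integral>\<^sup>+ y. ennreal (y powr (1 - 1 / real p)) * indicator {0<..} y \<partial>m)"
proof -
  have sm[measurable_cong]: "sets m = sets borel" using m by (simp add: speed_measure_def)
  interpret M: prob_space M using bm by (simp add: brownian_motion_from_def)
  interpret m: sigma_finite_measure m by (rule speed_measure_sigma_finite[OF m])
  interpret P: pair_sigma_finite m M by standard
  let ?v = "\<lambda>y. 1 / (y powr (1 - 1 / real p)) ^ (p - 1)"
  let ?F = "\<lambda>y \<omega>. ennreal (?v y) * local_moment (\<lambda>s. B s \<omega>) p y * indicator {0<..} y"
  have F: "case_prod ?F \<in> borel_measurable (m \<Otimes>\<^sub>M M)"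
    using weighted_moment_measurable[OF bm m, of p] by (simp add: case_prod_beta')
  have "(\<integral>\<^sup>+ \<omega>. weighted_moment m p (\<lambda>s. B s \<omega>) \<partial>M) = (\<integral>\<^sup>+ y. (\<integral>\<^sup>+ \<omega>. ?F y \<omega> \<partial>M) \<partial>m)"
    unfolding weighted_moment_def by (rule P.Fubini'[OF F])
  also have "\<dots> \<le> (\<integral>\<^sup>+ y. ennreal (fact p * 5 ^ p * x) * (ennreal (y powr (1 - 1 / real p)) * indicator {0<..} y) \<partial>m)"
  proof (intro nn_integral_mono)
    fix y :: real
    show "(\<integral>\<^sup>+ \<omega>. ?F y \<omega> \<partial>M) \<le> ennreal (fact p * 5 ^ p * x) * (ennreal (y powr (1 - 1 / real p)) * indicator {0<..} y)"
    proof (cases "0 < y")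
      case True
      have Bm: "B s \<in> borel_measurable M" if "0 \<le> s" for s
        using bm that by (simp add: brownian_motion_from_def)
      have [measurable]: "(\<lambda>\<omega>. local_moment (\<lambda>s. B s \<omega>) p y) \<in> borel_measurable M"
        using measurable_compose[OF measurable_Pair1'[of y borel M] local_moment_measurable[OF Bm]] by simp
      have "(\<integral>\<^sup>+ \<omega>. ?F y \<omega> \<partial>M) = ennreal (?v y) * (\<integral>\<^sup>+ \<omega>. local_moment (\<lambda>s. B s \<omega>) p y \<partial>M)"
        using True by (simp add: nn_integral_cmult)
      also have "\<dots> \<le> ennreal (?v y) * ennreal (fact p * (5 * y) ^ p * (x / y))"
        by (intro mult_left_mono local_moment_expectation[OF bm x True p]) auto
      also have "\<dots> = ennreal (fact p * 5 ^ p * x * (y powr (1 - 1 / real p)))"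
      proof -
        have "(y powr (1 - 1 / real p)) ^ (p - 1) * y powr (1 - 1 / real p) = (y powr (1 - 1 / real p)) ^ p"
          by (rule power_minus_mult[OF p])
        also have "\<dots> = y powr (real p - 1)"
          using p True by (simp add: powr_realpow[symmetric] powr_powr algebra_simps)
        also have "\<dots> = y ^ p / y"
          using True by (simp add: powr_diff powr_realpow)
        finally have e: "(y powr (1 - 1 / real p)) ^ (p - 1) * y powr (1 - 1 / real p) = y ^ p / y" .
        have "y ^ p / y / (y powr (1 - 1 / real p)) ^ (p - 1) = y powr (1 - 1 / real p)"
          unfolding e[symmetric] using True by simp
        then have "?v y * (fact p * (5 * y) ^ p * (x / y)) = fact p * 5 ^ p * x * (y powr (1 - 1 / real p))"
          by (simp add: power_mult_distrib ac_simps divide_inverse)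
        then show ?thesis by (simp add: ennreal_mult'[symmetric])
      qed
      also have "\<dots> = ennreal (fact p * 5 ^ p * x) * ennreal (y powr (1 - 1 / real p))"
        using x by (simp add: ennreal_mult')
      finally show ?thesis using True by simp
    qed simp
  qed
  also have "\<dots> = ennreal (fact p * 5 ^ p * x) * (\<integral>\<^sup>+ y. ennreal (y powr (1 - 1 / real p)) * indicator {0<..} y \<partial>m)"
    by (intro nn_integral_cmult) measurable
  finally show ?thesis .
qed

context local_time_path
begin

lemma clock_le_weighted_moment:
  assumes m: "speed_measure m" and T: "0 \<le> T" "\<And>r. 0 \<le> r \<Longrightarrow> r < T \<Longrightarrow> 0 < b r"
    and a: "0 < a" and p: "0 < p"
    and meas: "(\<lambda>y. local_moment b p y) \<in> borel_measurable borel"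
  shows "clock m T \<le> ennreal a * (\<integral>\<^sup>+ y. ennreal (y powr (1 - 1 / real p)) * indicator {0<..} y \<partial>m)
      + ennreal (2 ^ p / a ^ (p - 1)) * weighted_moment m p b"
proof -
  have sm[measurable_cong]: "sets m = sets borel" using m by (simp add: speed_measure_def)
  note [measurable] = meas
  let ?w = "\<lambda>y. y powr (1 - 1 / real p)"
  have "clock m T \<le> (\<integral>\<^sup>+ y. ennreal a * (ennreal (?w y) * indicator {0<..} y)
      + ennreal (2 ^ p / a ^ (p - 1)) * (ennreal (1 / ?w y ^ (p - 1)) * local_moment b p y * indicator {0<..} y) \<partial>m)"
    unfolding clock_def[OF m]
  proof (rule nn_integral_mono_AE)
    show "AE y in m. ennreal (l y T) \<le> ennreal a * (ennreal (?w y) * indicator {0<..} y)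
      + ennreal (2 ^ p / a ^ (p - 1)) * (ennreal (1 / ?w y ^ (p - 1)) * local_moment b p y * indicator {0<..} y)"
      using AE_speed_pos[OF m]
    proof eventually_elim
      case (elim y)
      have "ennreal (l y T) \<le> ennreal (a * ?w y + 2 ^ p / a ^ (p - 1) * (1 / ?w y ^ (p - 1) * (l y T / 2) ^ p))"
        using elim a p l_nonneg by (intro ennreal_leI le_threshold_plus_power) auto
      also have "\<dots> = ennreal a * ennreal (?w y) + ennreal (2 ^ p / a ^ (p - 1)) * (ennreal (1 / ?w y ^ (p - 1)) * ennreal ((l y T / 2) ^ p))"
        using a l_nonneg[of y T] by (simp add: ennreal_mult'[symmetric])
      also have "\<dots> \<le> ennreal a * ennreal (?w y) + ennreal (2 ^ p / a ^ (p - 1)) * (ennreal (1 / ?w y ^ (p - 1)) * local_moment b p y)"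
        using elim p by (intro add_left_mono mult_left_mono local_time_power_le_local_moment T) auto
      finally show ?case using elim by simp
    qed
  qed
  also have "\<dots> = ennreal a * (\<integral>\<^sup>+ y. ennreal (?w y) * indicator {0<..} y \<partial>m)
      + ennreal (2 ^ p / a ^ (p - 1)) * weighted_moment m p b"
  proof -
    let ?F = "\<lambda>y. ennreal (?w y) * indicator {0<..} y"
    let ?G = "\<lambda>y. ennreal (1 / ?w y ^ (p - 1)) * local_moment b p y * indicator {0<..} y"
    have F: "?F \<in> borel_measurable m" and G: "?G \<in> borel_measurable m"
      unfolding measurable_cong_sets[OF sm refl] by measurable
    have "(\<integral>\<^sup>+ y. ennreal a * ?F y + ennreal (2 ^ p / a ^ (p - 1)) * ?G y \<partial>m)
        = (\<integral>\<^sup>+ y. ennreal a * ?F y \<partial>m) + (\<integral>\<^sup>+ y. ennreal (2 ^ p / a ^ (p - 1)) * ?G y \<partial>m)"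
      by (intro nn_integral_add borel_measurable_times_ennreal borel_measurable_const F G)
    then show ?thesis
      unfolding weighted_moment_def nn_integral_cmult[OF F] nn_integral_cmult[OF G] .
  qed
  finally show ?thesis .
qed

end

text \<open>Survival past \<open>t\<close> forces the clock at the first zero above
  \<open>t\<close>. The threshold a = t/(2W) limits the deterministic half of the clock to t/2,
  leaving at least t/2 for the random half.\<close>

lemma absorption_time_le:
  assumes bm: "brownian_motion_from M x B" and lt: "local_times M B L" and m: "speed_measure m"
    and x: "0 < x" and t: "0 < t" and p: "0 < p"
    and W: "(\<integral>\<^sup>+ y. ennreal (y powr (1 - 1 / real p)) * indicator {0<..} y \<partial>m) \<le> ennreal W" and W0: "0 < W"
  shows "AE \<omega> in M. ereal t < absorption_time m B L \<omega> \<longrightarrow>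
    ennreal (t / 2) \<le> ennreal (2 ^ p / (t / (2 * W)) ^ (p - 1)) * weighted_moment m p (\<lambda>s. B s \<omega>)"
proof -
  have "AE \<omega> in M. B 0 \<omega> = x" "AE \<omega> in M. continuous_on {0..} (\<lambda>s. B s \<omega>)"
    using bm by (auto simp: brownian_motion_from_def)
  moreover note lt[unfolded local_times_def]
  \<comment> \<open>The sign -1 forces the path to reach 0; the sign 1 makes the clock grow again
    afterwards, so that its inverse is an infimum over a nonempty set.\<close>
  moreover note brownian_oscillates[OF bm, of 1, simplified] brownian_oscillates[OF bm, of "-1", simplified]
  ultimately show ?thesis using AE_space
  proof eventually_elim
    case (elim \<omega>)
    let ?b = "\<lambda>s. B s \<omega>" and ?l = "\<lambda>y s. L y s \<omega>"
    interpret local_time_path ?b ?l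
      using elim(2,3) by unfold_locales auto
    obtain s where "0 < s" "B s \<omega> < 0" using elim(5) by blast
    then obtain T where T: "0 \<le> T" "B T \<omega> = 0" "\<And>r. 0 \<le> r \<Longrightarrow> r < T \<Longrightarrow> 0 < B r \<omega>"
      using first_zero[OF b_cont, of s] elim(1) x by auto
    have clock: "clock m s = additive_functional m L s \<omega>" for s
      by (simp add: clock_def[OF m] additive_functional_def)
    show ?case
    proof
      assume abs: "ereal t < absorption_time m B L \<omega>"
      have "\<not> clock m T \<le> ennreal t"
      proof
        assume "clock m T \<le> ennreal t"
        then obtain u where u: "0 \<le> u" "u \<le> t" "B (Inf {s. 0 \<le> s \<and> clock m s > ennreal u}) \<omega> = 0"
          using clock_inverse_at_zero[OF m T(1,2) _ elim(4)[rule_format] less_imp_le[OF t]] by blast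
        then have "absorption_time m B L \<omega> \<le> ereal u"
          unfolding absorption_time_def time_change_def clock by (intro Inf_lower) auto
        then show False using abs u by (metis ereal_less_eq(3) leD order_trans)
      qed
      then have 1: "ennreal t < clock m T" by simp
      let ?a = "t / (2 * W)" and ?c = "ennreal (2 ^ p / (t / (2 * W)) ^ (p - 1))"
      have Bm: "B s \<in> borel_measurable M" if "0 \<le> s" for s
        using bm that by (simp add: brownian_motion_from_def)
      have "(\<lambda>y. local_moment ?b p y) \<in> borel_measurable borel"
        using measurable_compose[OF measurable_Pair2'[OF elim(6), of borel] local_moment_measurable[OF Bm]] by simp
      then have "clock m T \<le> ennreal ?a * (\<integral>\<^sup>+ y. ennreal (y powr (1 - 1 / real p)) * indicator {0<..} y \<partial>m)
        + ?c * weighted_moment m p ?b"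
        using t W0 by (intro clock_le_weighted_moment[OF m T(1,3) _ p]) auto
      also have "\<dots> \<le> ennreal ?a * ennreal W + ?c * weighted_moment m p ?b"
        by (intro add_right_mono mult_left_mono W) auto
      also have "ennreal ?a * ennreal W = ennreal (t / 2)"
        using W0 t by (simp add: ennreal_mult'[symmetric])
      finally have 2: "ennreal t \<le> ennreal (t / 2) + ?c * weighted_moment m p ?b"
        using 1 by (meson less_imp_le order_trans)
      show "ennreal (t / 2) \<le> ?c * weighted_moment m p ?b"
      proof (cases "?c * weighted_moment m p ?b")
        case (real r)
        then show ?thesis using 2 t by (simp add: ennreal_plus[symmetric] del: ennreal_plus)
      qed simp
    qed
  qed
qed

theorem mainTheorem7:
  fixes m :: "real measure" and C \<rho> :: real
  assumes speed: "speed_measure m"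
    and cdi: "(\<integral>\<^sup>+ y. ennreal y * indicator {1..} y \<partial>m) < \<infinity>"
    and hits0: "(\<integral>\<^sup>+ y. ennreal y * indicator {0<..<1} y \<partial>m) < \<infinity>"
    and Cpos: "C > 0" and rhopos: "\<rho> > 0"
    and Ibound: "\<And>x. 0 < x \<Longrightarrow> x < 1 \<Longrightarrow>
                   (\<integral>\<^sup>+ y. ennreal y * indicator {0<..x} y \<partial>m) \<le> ennreal (C * x powr \<rho>)"
  shows "\<forall>t>0. \<exists>At::real. \<forall>x>0. \<forall>(M::'a measure) B L.
           brownian_motion_from M x B \<and> local_times M B L \<longrightarrow>
           (\<exists>E\<in>sets M. {\<omega> \<in> space M. ereal t < absorption_time m B L \<omega>} \<subseteq> E
                        \<and> measure M E \<le> At * x)"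
proof (intro allI impI)
  fix t :: real assume t: "0 < t"
  obtain p :: nat where p: "0 < p" "1 / real p < \<rho>"
    using real_arch_inverse[of \<rho>] rhopos by (auto simp: inverse_eq_divide)
  let ?I = "\<integral>\<^sup>+ y. ennreal (y powr (1 - 1 / real p)) * indicator {0<..} y \<partial>m"
  have "?I < \<infinity>"
    using speed p by (intro weight_integral_finite[OF _ cdi hits0 Cpos Ibound]) (auto simp: speed_measure_def)
  then obtain w where w: "0 \<le> w" "?I = ennreal w" by (cases ?I) auto
  \<comment> \<open>Adding 1 makes \<open>W\<close> positive, so that it can appear in the
    denominator of the threshold.\<close>
  define W where "W = w + 1"
  have W: "?I \<le> ennreal W" "0 < W" using w by (auto simp: W_def intro!: ennreal_leI)
  define c where "c = 2 ^ p / (t / (2 * W)) ^ (p - 1)"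
  have c: "0 \<le> c" using t W by (simp add: c_def)
  define A where "A = 2 / t * c * (fact p * 5 ^ p) * W"
  show "\<exists>At::real. \<forall>x>0. \<forall>(M::'a measure) B L.
           brownian_motion_from M x B \<and> local_times M B L \<longrightarrow>
           (\<exists>E\<in>sets M. {\<omega> \<in> space M. ereal t < absorption_time m B L \<omega>} \<subseteq> E
                        \<and> measure M E \<le> At * x)"
  proof (intro exI[of _ A] allI impI, elim conjE)
    fix x :: real and M :: "'a measure" and B L
    assume x: "0 < x" and bm: "brownian_motion_from M x B" and lt: "local_times M B L"
    interpret prob_space M using bm by (simp add: brownian_motion_from_def)
    let ?R = "\<lambda>\<omega>. weighted_moment m p (\<lambda>s. B s \<omega>)"
    have Rm[measurable]: "?R \<in> borel_measurable M"
    proof -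
      interpret m: sigma_finite_measure m by (rule speed_measure_sigma_finite[OF speed])
      define f where "f \<omega> y = ennreal (1 / (y powr (1 - 1 / real p)) ^ (p - 1))
        * local_moment (\<lambda>s. B s \<omega>) p y * indicator {0<..} y" for \<omega> y
      have "case_prod f \<in> borel_measurable (M \<Otimes>\<^sub>M m)"
        using measurable_pair_swap[OF weighted_moment_measurable[OF bm speed, of p]]
        by (simp add: f_def case_prod_beta')
      then have "(\<lambda>\<omega>. \<integral>\<^sup>+ y. f \<omega> y \<partial>m) \<in> borel_measurable M"
        by (rule m.borel_measurable_nn_integral)
      then show ?thesis unfolding f_def weighted_moment_def .
    qed
    obtain N where N: "{\<omega> \<in> space M. \<not> (ereal t < absorption_time m B L \<omega> \<longrightarrow>
        ennreal (t / 2) \<le> ennreal c * ?R \<omega>)} \<subseteq> N" "emeasure M N = 0" "N \<in> sets M"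
      unfolding c_def by (rule AE_E[OF absorption_time_le[OF bm lt speed x t p(1) W]])
    define S where "S = {\<omega> \<in> space M. ennreal (t / 2) \<le> ennreal c * ?R \<omega>}"
    have Sm: "S \<in> sets M" unfolding S_def by measurable
    have "emeasure M S \<le> emeasure M {\<omega> \<in> space M. 1 \<le> ennreal (2 / t * c) * ?R \<omega>}"
    proof (rule emeasure_mono)
      show "S \<subseteq> {\<omega> \<in> space M. 1 \<le> ennreal (2 / t * c) * ?R \<omega>}"
      proof
        fix \<omega> assume "\<omega> \<in> S"
        then have "\<omega> \<in> space M" "ennreal (2 / t) * ennreal (t / 2) \<le> ennreal (2 / t) * (ennreal c * ?R \<omega>)"
          by (auto simp: S_def intro!: mult_left_mono)
        then show "\<omega> \<in> {\<omega> \<in> space M. 1 \<le> ennreal (2 / t * c) * ?R \<omega>}"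
          using t c by (simp add: ennreal_mult'[symmetric] mult.assoc[symmetric])
      qed
    qed measurable
    also have "\<dots> \<le> ennreal (2 / t * c) * (\<integral>\<^sup>+ \<omega>. ?R \<omega> * indicator (space M) \<omega> \<partial>M)"
      by (intro nn_integral_Markov_inequality) auto
    also have "(\<integral>\<^sup>+ \<omega>. ?R \<omega> * indicator (space M) \<omega> \<partial>M) = (\<integral>\<^sup>+ \<omega>. ?R \<omega> \<partial>M)"
      by (intro nn_integral_cong) auto
    also have "ennreal (2 / t * c) * \<dots> \<le> ennreal (2 / t * c) * (ennreal (fact p * 5 ^ p * x) * ennreal W)"
      by (intro mult_left_mono order_trans[OF weighted_moment_expectation[OF bm speed x p(1)]] W) auto
    also have "\<dots> = ennreal (A * x)"
      using x t c W by (simp add: A_def ennreal_mult'[symmetric] ac_simps)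
    finally have "emeasure M S \<le> ennreal (A * x)" .
    moreover have "0 \<le> A * x" using t c W x by (simp add: A_def)
    ultimately have "measure M S \<le> A * x" by (simp add: emeasure_eq_measure)
    then have "measure M (S \<union> N) \<le> A * x"
      using measure_Un_null_set[OF Sm, of N] N by (simp add: null_sets_def)
    moreover have "{\<omega> \<in> space M. ereal t < absorption_time m B L \<omega>} \<subseteq> S \<union> N"
      using N(1) by (auto simp: S_def)
    ultimately show "\<exists>E\<in>sets M. {\<omega> \<in> space M. ereal t < absorption_time m B L \<omega>} \<subseteq> E \<and> measure M E \<le> A * x"
      using Sm N(3) by (intro bexI[of _ "S \<union> N"]) auto
  qed
qed

end
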